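(* Let $H_1,H_2$ be separable complex Hilbert spaces with orthonormal bases $\{\phi_i\}$ of $H_1$ and $\{\psi_i\}$ of $H_2$, and let $\mathcal{A}=\{\phi_i,\psi_j : i,j=1,2,\ldots\}$. Let $R\colon\mathcal{L}(\mathcal{L}_{\mathrm{HS}}(H_1,H_2))\to\mathcal{L}(H_1\otimes H_2)$ be defined by $R(B)=J_{\mathcal{A}}BJ_{\mathcal{A}}^*$ and let $S\colon\mathcal{L}(H_1\otimes H_2)\to\mathcal{L}(\mathcal{L}_{\mathrm{HS}}(H_1,H_2))$ be defined by $S(C)=J_{\mathcal{A}}^*CJ_{\mathcal{A}}$. Then $R$ and $S$ are $C^*$-algebra isomorphisms and $S=R^{-1}$.
   Context: Inner products are linear in the second argument and anti-linear in the first. $\mathcal{L}(H_1,H_2)$ is the set of bounded linear operators from $H_1$ to $H_2$, and $\mathcal{L}(H)=\mathcal{L}(H,H)$. $\mathcal{L}_{\mathrm{HS}}(H_1,H_2)$ is the set of Hilbert-Schmidt operators, i.e. $A\in\mathcal{L}(H_1,H_2)$ with $\mathrm{tr}(A^*A)<\infty$; it is a Hilbert space under $\langle A,B\rangle_{\mathrm{HS}}=\mathrm{tr}(A^*B)$. $H_1\otimes H_2$ is the Hilbert space tensor product. The map $J_{\mathcal{A}}\colon\mathcal{L}_{\mathrm{HS}}(H_1,H_2)\to H_1\otimes H_2$ is $J_{\mathcal{A}}(A)=\sum_{i,j}\langle\psi_i,A\phi_j\rangle\,\phi_j\otimes\psi_i$, and $J_{\mathcal{A}}^*$ is its Hilbert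 space adjoint. $\mathcal{L}(H_1\otimes H_2)$ and $\mathcal{L}(\mathcal{L}_{\mathrm{HS}}(H_1,H_2))$ are regarded as $C^*$-algebras in the usual way (composition, adjoint, operator norm). *)

theory Defs
  imports "HOL-Analysis.Analysis"
begin

section \<open>Complex Hilbert spaces\<close>

class complex_normed_vector = real_normed_vector +
  fixes scaleC :: "complex \<Rightarrow> 'a \<Rightarrow> 'a" (infixr "*\<^sub>C" 75)
  assumes scaleC_add_right: "a *\<^sub>C (x + y) = a *\<^sub>C x + a *\<^sub>C y"
    and scaleC_add_left: "(a + b) *\<^sub>C x = a *\<^sub>C x + b *\<^sub>C x"
    and scaleC_scaleC: "a *\<^sub>C b *\<^sub>C x = (a * b) *\<^sub>C x"
    and scaleR_scaleC: "r *\<^sub>R x = complex_of_real r *\<^sub>C x"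
    and norm_scaleC: "norm (a *\<^sub>C x) = cmod a * norm x"

lemma scaleC_one [simp]: "1 *\<^sub>C (x :: 'a :: complex_normed_vector) = x"
  using scaleR_scaleC[of 1 x] by simp

global_interpretation complex_vector:
  vector_space "scaleC :: complex \<Rightarrow> 'a \<Rightarrow> 'a :: complex_normed_vector"
  by unfold_locales (simp_all add: scaleC_add_right scaleC_add_left scaleC_scaleC)

abbreviation cspan :: "'a :: complex_normed_vector set \<Rightarrow> 'a set" where
  "cspan \<equiv> module.span scaleC"

text \<open>
  The norm is that of the underlying real inner product space, so by \<open>inner_eq_Re_cinner\<close>
  it is the one induced by \<open>cinner\<close>.  The form is linear in the second argument.
\<close>

class complex_inner = complex_normed_vector + real_inner +
  fixes cinner :: "'a \<Rightarrow> 'a \<Rightarrow> complex"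
  assumes cinner_commute: "cinner x y = cnj (cinner y x)"
    and cinner_add_right: "cinner x (y + z) = cinner x y + cinner x z"
    and cinner_scaleC_right: "cinner x (a *\<^sub>C y) = a * cinner x y"
    and inner_eq_Re_cinner: "inner x y = Re (cinner x y)"

class chilbert_space = complex_inner + complete_space

subclass (in chilbert_space) banach ..

lemma cinner_add_left:
  fixes x y z :: "'a :: complex_inner"
  shows "cinner (x + y) z = cinner x z + cinner y z"
  by (metis cinner_commute cinner_add_right complex_cnj_add)

lemma cinner_scaleC_left:
  fixes x y :: "'a :: complex_inner"
  shows "cinner (a *\<^sub>C x) y = cnj a * cinner x y"
  by (metis cinner_commute cinner_scaleC_right complex_cnj_mult)

lemma cinner_zero [simp]:
  fixes x :: "'a :: complex_inner"
  shows "cinner x 0 = 0" "cinner 0 x = 0"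
  using cinner_add_right[of x 0 0] cinner_add_left[of 0 0 x] by auto

lemma cinner_minus:
  fixes x y :: "'a :: complex_inner"
  shows "cinner x (- y) = - cinner x y" "cinner (- x) y = - cinner x y"
  using cinner_add_right[of x y "-y"] cinner_add_left[of x "-x" y]
  by (auto simp: add_eq_0_iff)

lemma cinner_diff:
  fixes x y z :: "'a :: complex_inner"
  shows "cinner x (y - z) = cinner x y - cinner x z"
    "cinner (x - y) z = cinner x z - cinner y z"
  using cinner_add_right[of x y "-z"] cinner_add_left[of x "-y" z]
  by (auto simp: cinner_minus)

lemma cinner_sum_right:
  fixes x :: "'a :: complex_inner"
  shows "cinner x (sum f F) = (\<Sum>i\<in>F. cinner x (f i))"
  by (induction F rule: infinite_finite_induct) (auto simp: cinner_add_right)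

lemma cinner_sum_left:
  fixes x :: "'a :: complex_inner"
  shows "cinner (sum f F) x = (\<Sum>i\<in>F. cinner (f i) x)"
  by (induction F rule: infinite_finite_induct) (auto simp: cinner_add_left)

lemma cinner_self:
  fixes x :: "'a :: complex_inner"
  shows "cinner x x = complex_of_real ((norm x)\<^sup>2)"
proof (rule complex_eqI)
  show "Re (cinner x x) = Re (complex_of_real ((norm x)\<^sup>2))"
    by (simp flip: inner_eq_Re_cinner add: power2_norm_eq_inner)
  have "Im (cinner x x) = - Im (cinner x x)"
    by (metis cinner_commute cnj.simps(2))
  then show "Im (cinner x x) = Im (complex_of_real ((norm x)\<^sup>2))" by simp
qed

lemma cinner_eqI:
  fixes x y :: "'a :: complex_inner"
  assumes "\<And>z. cinner z x = cinner z y"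
  shows "x = y"
proof -
  have "cinner (x - y) (x - y) = 0" using assms by (simp add: cinner_diff)
  then show ?thesis by (simp add: cinner_self)
qed

lemma norm_cinner_le:
  fixes x y :: "'a :: complex_inner"
  shows "cmod (cinner x y) \<le> norm x * norm y"
proof (cases "cinner x y = 0")
  case False
  define a where "a = cnj (cinner x y) / cmod (cinner x y)"
  have na: "cmod a = 1" using False by (simp add: a_def norm_divide)
  have "a * cinner x y = complex_of_real ((cmod (cinner x y))\<^sup>2) / cmod (cinner x y)"
    unfolding a_def by (metis complex_norm_square mult.commute times_divide_eq_left)
  also have "\<dots> = complex_of_real (cmod (cinner x y))"
    using False by (simp add: power2_eq_square)
  finally have "cmod (cinner x y) = inner x (a *\<^sub>C y)"
    by (simp add: inner_eq_Re_cinner cinner_scaleC_right)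
  also have "\<dots> \<le> norm x * norm (a *\<^sub>C y)" by (rule norm_cauchy_schwarz)
  also have "\<dots> = norm x * norm y" by (simp add: norm_scaleC na)
  finally show ?thesis .
qed simp

lemma bounded_linear_scaleC: "bounded_linear (\<lambda>x :: 'a :: complex_normed_vector. a *\<^sub>C x)"
  by (rule bounded_linear_intro[where K = "cmod a"])
    (simp_all add: scaleC_add_right scaleR_scaleC scaleC_scaleC norm_scaleC mult.commute)

lemma bounded_linear_cinner_right:
  "bounded_linear (\<lambda>y. cinner (x :: 'a :: complex_inner) y)"
  by (rule bounded_linear_intro[where K = "norm x"])
    (simp_all add: cinner_add_right scaleR_scaleC cinner_scaleC_right scaleR_conv_of_real
      norm_cinner_le mult.commute[of "norm _" "norm x"])

lemma bounded_linear_cinner_left: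
  "bounded_linear (\<lambda>y. cinner y (x :: 'a :: complex_inner))"
  by (rule bounded_linear_intro[where K = "norm x"])
    (simp_all add: cinner_add_left scaleR_scaleC cinner_scaleC_left scaleR_conv_of_real
      norm_cinner_le)

definition orthonormal_basis :: "('i \<Rightarrow> 'a :: complex_inner) \<Rightarrow> 'i set \<Rightarrow> bool" where
  "orthonormal_basis e I \<longleftrightarrow>
     (\<forall>i\<in>I. \<forall>j\<in>I. cinner (e i) (e j) = (if i = j then 1 else 0)) \<and>
     closure (cspan (e ` I)) = UNIV"


subsection \<open>Orthogonal projection and existence of orthonormal bases\<close>

lemma orthogonal_projection_exists:
  fixes x :: "'a :: chilbert_space"
  assumes cl: "closed M" and sub: "complex_vector.subspace M"
  shows "\<exists>m\<in>M. \<forall>k\<in>M. cinner k (x - m) = 0"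
proof -
  have M0: "0 \<in> M" and Madd: "\<And>u v. u \<in> M \<Longrightarrow> v \<in> M \<Longrightarrow> u + v \<in> M"
    and Msc: "\<And>c u. u \<in> M \<Longrightarrow> c *\<^sub>C u \<in> M"
    using sub by (auto simp: complex_vector.subspace_def)
  have MscR: "c *\<^sub>R u \<in> M" if "u \<in> M" for c u using Msc[OF that] by (simp add: scaleR_scaleC)
  define d where "d = infdist x M"
  have d0: "d \<ge> 0" by (simp add: d_def infdist_nonneg)
  have dle: "d \<le> norm (x - u)" if "u \<in> M" for u
    using infdist_le[OF that, of x] by (simp add: d_def dist_norm)
  have "\<exists>u\<in>M. norm (x - u) < d + 1 / real (Suc n)" for n
  proof (rule ccontr)
    assume "\<not> ?thesis"
    then have "\<And>u. u \<in> M \<Longrightarrow> d + 1 / real (Suc n) \<le> dist x u" by (auto simp: dist_norm not_less)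
    moreover have "M \<noteq> {}" using M0 by auto
    ultimately have "d + 1 / real (Suc n) \<le> d"
      unfolding d_def infdist_notempty[OF \<open>M \<noteq> {}\<close>] by (intro cINF_greatest) auto
    then show False by (simp add: divide_le_0_iff)
  qed
  then obtain u where uM: "\<And>n. u n \<in> M" and u: "\<And>n. norm (x - u n) < d + 1 / real (Suc n)"
    by metis
  have lim: "(\<lambda>n. norm (x - u n)) \<longlonglongrightarrow> d"
  proof (rule real_tendsto_sandwich[of "\<lambda>_. d" _ _ "\<lambda>n. d + 1 / real (Suc n)"])
    show "(\<lambda>n. d + 1 / real (Suc n)) \<longlonglongrightarrow> d"
      using tendsto_add[OF tendsto_const[of d] LIMSEQ_Suc[OF lim_1_over_n]] by simp
  qed (use u dle[OF uM] in \<open>auto intro!: always_eventually less_imp_le\<close>)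
  have par: "(norm (u n - u k))\<^sup>2 \<le> 2 * (norm (x - u n))\<^sup>2 + 2 * (norm (x - u k))\<^sup>2 - 4 * d\<^sup>2"
    for n k
  proof -
    define w where "w = (1/2) *\<^sub>R (u n + u k)"
    have "w \<in> M" unfolding w_def by (intro MscR Madd uM)
    then have "d\<^sup>2 \<le> (norm (x - w))\<^sup>2" using dle d0 by (intro power_mono) auto
    moreover have "(norm (u n - u k))\<^sup>2
        = 2 * (norm (x - u n))\<^sup>2 + 2 * (norm (x - u k))\<^sup>2 - 4 * (norm (x - w))\<^sup>2"
    proof -
      have par: "(norm (q - p))\<^sup>2 = 2 * (norm p)\<^sup>2 + 2 * (norm q)\<^sup>2 - (norm (p + q))\<^sup>2" for p q :: 'a
        unfolding power2_norm_eq_inner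
        by (simp add: inner_diff_left inner_diff_right inner_add_left inner_add_right
            inner_commute[of q p])
      have "2 *\<^sub>R (x - w) = (x - u n) + (x - u k)"
        by (simp add: w_def scaleR_diff_right scaleR_2)
      then have "norm ((x - u n) + (x - u k)) = 2 * norm (x - w)"
        by (metis abs_numeral norm_scaleR)
      with par[of "x - u k" "x - u n"] show ?thesis by (simp add: power_mult_distrib)
    qed
    ultimately show ?thesis by linarith
  qed
  have "Cauchy u"
  proof (rule CauchyI)
    fix e :: real assume e: "e > 0"
    have "(\<lambda>n. (norm (x - u n))\<^sup>2) \<longlonglongrightarrow> d\<^sup>2" using lim by (intro tendsto_intros)
    moreover have "d\<^sup>2 < d\<^sup>2 + e\<^sup>2 / 4" using e by simp
    ultimately have "\<forall>\<^sub>F n in sequentially. (norm (x - u n))\<^sup>2 < d\<^sup>2 + e\<^sup>2 / 4"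
      by (rule order_tendstoD)
    then obtain N where N: "\<And>n. n \<ge> N \<Longrightarrow> (norm (x - u n))\<^sup>2 < d\<^sup>2 + e\<^sup>2 / 4"
      by (auto simp: eventually_sequentially)
    have "norm (u m - u n) < e" if "m \<ge> N" "n \<ge> N" for m n
    proof (rule power_less_imp_less_base[where n = 2])
      show "(norm (u m - u n))\<^sup>2 < e\<^sup>2" using par[of m n] N[OF that(1)] N[OF that(2)] by linarith
    qed (use e in simp)
    then show "\<exists>N. \<forall>m\<ge>N. \<forall>n\<ge>N. norm (u m - u n) < e" by blast
  qed
  then obtain m where m: "u \<longlonglongrightarrow> m" using Cauchy_convergent convergent_def by blast
  have mM: "m \<in> M" using closed_sequentially[OF cl _ m] uM by auto
  have "(\<lambda>n. norm (x - u n)) \<longlonglongrightarrow> norm (x - m)" using m by (intro tendsto_intros)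
  then have nd: "norm (x - m) = d" using lim LIMSEQ_unique by blast
  have re: "inner (x - m) k = 0" if "k \<in> M" for k
  proof (rule ccontr)
    assume ne: "inner (x - m) k \<noteq> 0"
    then have k: "inner k k > 0" by auto
    define t where "t = inner (x - m) k / inner k k"
    have "norm (x - m) \<le> norm (x - (m + t *\<^sub>R k))"
      using dle[OF Madd[OF mM MscR[OF that, of t]]] nd by simp
    then have "(norm (x - m))\<^sup>2 \<le> (norm ((x - m) - t *\<^sub>R k))\<^sup>2"
      by (simp add: diff_diff_eq power_mono)
    also have "\<dots> = (norm (x - m))\<^sup>2 - 2 * t * inner (x - m) k + t * t * inner k k"
    proof -
      have "inner (z - v) (z - v) = inner z z - 2 * inner z v + inner v v" for z v :: 'a
        by (simp add: inner_diff_left inner_diff_right inner_commute[of v z])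
      from this[of "x - m" "t *\<^sub>R k"] show ?thesis
        unfolding power2_norm_eq_inner inner_scaleR_left inner_scaleR_right by simp
    qed
    also have "\<dots> = (norm (x - m))\<^sup>2 - (inner (x - m) k)\<^sup>2 / inner k k"
      using k by (simp add: t_def power2_eq_square)
    finally have "(inner (x - m) k)\<^sup>2 / inner k k \<le> 0" by simp
    then show False using ne k by (simp add: divide_le_0_iff)
  qed
  have "cinner k (x - m) = 0" if "k \<in> M" for k
  proof (rule complex_eqI)
    show "Re (cinner k (x - m)) = Re 0"
      using re[OF that] by (simp flip: inner_eq_Re_cinner add: inner_commute[of k])
    show "Im (cinner k (x - m)) = Im 0"
    proof -
      have "inner (\<i> *\<^sub>C k) (x - m) = 0" using re[OF Msc[OF that]] by (metis inner_commute)
      then show ?thesis by (simp add: inner_eq_Re_cinner cinner_scaleC_left)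
    qed
  qed
  with mM show ?thesis by blast
qed

lemma subspace_closure_cspan: "complex_vector.subspace (closure (cspan S))"
  for S :: "'a :: complex_normed_vector set"
  unfolding complex_vector.subspace_def
proof (intro conjI ballI allI)
  show "0 \<in> closure (cspan S)" using closure_subset complex_vector.span_zero by blast
next
  fix x y assume "x \<in> closure (cspan S)" "y \<in> closure (cspan S)"
  then obtain f g where "\<And>n. f n \<in> cspan S" "f \<longlonglongrightarrow> x" "\<And>n. g n \<in> cspan S" "g \<longlonglongrightarrow> y"
    by (auto simp: closure_sequential)
  then have "(\<forall>n. f n + g n \<in> cspan S) \<and> (\<lambda>n. f n + g n) \<longlonglongrightarrow> x + y"
    by (auto intro: complex_vector.span_add tendsto_add)
  then show "x + y \<in> closure (cspan S)"
    unfolding closure_sequential by (rule exI[of _ "\<lambda>n. f n + g n"])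
next
  fix c x assume "x \<in> closure (cspan S)"
  then obtain f where "\<And>n. f n \<in> cspan S" "f \<longlonglongrightarrow> x" by (auto simp: closure_sequential)
  then have "(\<forall>n. c *\<^sub>C f n \<in> cspan S) \<and> (\<lambda>n. c *\<^sub>C f n) \<longlonglongrightarrow> c *\<^sub>C x"
    by (auto intro: complex_vector.span_scale bounded_linear.tendsto[OF bounded_linear_scaleC])
  then show "c *\<^sub>C x \<in> closure (cspan S)"
    unfolding closure_sequential by (rule exI[of _ "\<lambda>n. c *\<^sub>C f n"])
qed

lemma orthonormal_basis_exists:
  "\<exists>E :: 'a :: chilbert_space set. orthonormal_basis (\<lambda>e. e) E"
proof -
  define ons where
    "ons = {E :: 'a set. \<forall>i\<in>E. \<forall>j\<in>E. cinner i j = (if i = j then 1 else 0)}"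
  have "\<exists>M\<in>ons. \<forall>X\<in>ons. M \<subseteq> X \<longrightarrow> X = M"
  proof (rule subset_Zorn')
    fix C assume C: "subset.chain ons C"
    show "\<Union>C \<in> ons"
      unfolding ons_def
    proof (intro CollectI ballI)
      fix i j assume "i \<in> \<Union>C" "j \<in> \<Union>C"
      then obtain X Y where XY: "X \<in> C" "i \<in> X" "Y \<in> C" "j \<in> Y" by auto
      then have "X \<subseteq> Y \<or> Y \<subseteq> X" "X \<in> ons" "Y \<in> ons"
        using C by (auto simp: subset_chain_def)
      then show "cinner i j = (if i = j then 1 else 0)"
        using XY unfolding ons_def by blast
    qed
  qed
  then obtain E where E: "E \<in> ons" and max: "\<And>X. X \<in> ons \<Longrightarrow> E \<subseteq> X \<Longrightarrow> X = E" by blast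
  have "closure (cspan E) = UNIV"
  proof (rule ccontr)
    assume "closure (cspan E) \<noteq> UNIV"
    then obtain x where x: "x \<notin> closure (cspan E)" by auto
    obtain m where m: "m \<in> closure (cspan E)"
      and orth: "\<And>k. k \<in> closure (cspan E) \<Longrightarrow> cinner k (x - m) = 0"
      using orthogonal_projection_exists[OF closed_closure subspace_closure_cspan] by metis
    have ne: "x - m \<noteq> 0" using x m by auto
    define v where "v = complex_of_real (1 / norm (x - m)) *\<^sub>C (x - m)"
    have nv: "cinner v v = 1"
      using ne by (simp add: cinner_self v_def norm_scaleC norm_divide)
    have ov: "cinner k v = 0" if "k \<in> E" for k
    proof -
      have "k \<in> closure (cspan E)" using that closure_subset complex_vector.span_base by blast
      then show ?thesis using orth by (simp add: v_def cinner_scaleC_right)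
    qed
    have ov': "cinner v k = 0" if "k \<in> E" for k
      using ov[OF that] by (subst cinner_commute) simp
    have "insert v E \<in> ons"
      unfolding ons_def
    proof (intro CollectI ballI)
      fix i j assume "i \<in> insert v E" "j \<in> insert v E"
      then consider "i = v" "j = v" | "i = v" "j \<in> E" "j \<noteq> v" | "i \<in> E" "j = v" "i \<noteq> v"
        | "i \<in> E" "j \<in> E" by blast
      then show "cinner i j = (if i = j then 1 else 0)"
      proof cases
        case 4
        then show ?thesis using E unfolding ons_def by blast
      qed (use nv ov ov' in auto)
    qed
    then have "v \<in> E" using max by blast
    then show False using ov nv by fastforce
  qed
  with E have "orthonormal_basis (\<lambda>e. e) E"
    unfolding orthonormal_basis_def ons_def mem_Collect_eq image_ident by blast
  then show ?thesis by blast
qed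

lemma riesz_representation:
  fixes f :: "'a :: chilbert_space \<Rightarrow> complex"
  assumes f: "bounded_linear f" and fC: "\<And>c x. f (c *\<^sub>C x) = c * f x"
  shows "\<exists>y. \<forall>x. f x = cinner y x"
proof (cases "\<forall>x. f x = 0")
  case True
  then show ?thesis by (intro exI[of _ 0]) simp
next
  case False
  then obtain x where x: "f x \<noteq> 0" by blast
  interpret f: bounded_linear f by fact
  define M where "M = {u. f u = 0}"
  have cont: "continuous_on UNIV f"
    by (intro linear_continuous_on f)
  have "closed M"
    unfolding M_def using continuous_closed_vimage[of "{0}" f] cont
    by (auto simp: vimage_def continuous_on_eq_continuous_at)
  moreover have "complex_vector.subspace M"
    by (auto simp: complex_vector.subspace_def M_def f.add fC f.zero)
  ultimately obtain m where m: "m \<in> M" and orth: "\<And>k. k \<in> M \<Longrightarrow> cinner k (x - m) = 0"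
    using orthogonal_projection_exists by metis
  define z where "z = x - m"
  have fz: "f z \<noteq> 0" using x m by (simp add: z_def f.diff M_def)
  then have z: "cinner z z \<noteq> 0" using f.zero by (auto simp: cinner_self)
  define y where "y = cnj (f z / cinner z z) *\<^sub>C z"
  have "f w = cinner y w" for w
  proof -
    define k where "k = w - (f w / f z) *\<^sub>C z"
    have "k \<in> M" using fz by (simp add: k_def M_def f.diff fC)
    then have "cinner k z = 0" using orth by (simp add: z_def)
    then have "cinner z k = 0" by (subst cinner_commute) simp
    then have "cinner z w = (f w / f z) * cinner z z"
      by (simp add: k_def cinner_diff cinner_scaleC_right)
    then show ?thesis using fz z by (simp add: y_def cinner_scaleC_left)
  qed
  then show ?thesis by blast
qed


section \<open>Bounded complex-linear operators\<close>

typedef (overloaded) ('a, 'b) cblinfun =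
  "{f :: 'a :: complex_normed_vector \<Rightarrow> 'b :: complex_normed_vector.
      bounded_linear f \<and> (\<forall>c x. f (c *\<^sub>C x) = c *\<^sub>C f x)}"
  morphisms cblinfun_apply CBlinfun
  by (rule exI[of _ "\<lambda>_. 0"]) simp

notation cblinfun_apply (infixl "*\<^sub>V" 70)

setup_lifting type_definition_cblinfun

lemma cblinfun_eqI: "(\<And>x. A *\<^sub>V x = B *\<^sub>V x) \<Longrightarrow> A = B"
  by transfer auto

lemma bounded_linear_cblinfun_apply: "bounded_linear (cblinfun_apply A)"
  by transfer simp

lemma cblinfun_apply_scaleC: "A *\<^sub>V (c *\<^sub>C x) = c *\<^sub>C (A *\<^sub>V x)"
  by transfer simp

lemma cblinfun_apply_add: "A *\<^sub>V (x + y) = A *\<^sub>V x + A *\<^sub>V y"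
  by (rule linear_add[OF bounded_linear.linear[OF bounded_linear_cblinfun_apply]])

instantiation cblinfun :: (complex_normed_vector, complex_normed_vector) complex_normed_vector
begin

lift_definition norm_cblinfun :: "('a, 'b) cblinfun \<Rightarrow> real" is onorm .

lift_definition minus_cblinfun :: "('a, 'b) cblinfun \<Rightarrow> ('a, 'b) cblinfun \<Rightarrow> ('a, 'b) cblinfun"
  is "\<lambda>f g x. f x - g x"
  by (auto intro: bounded_linear_sub simp: complex_vector.scale_right_diff_distrib)

lift_definition uminus_cblinfun :: "('a, 'b) cblinfun \<Rightarrow> ('a, 'b) cblinfun"
  is "\<lambda>f x. - f x"
  by (auto intro: bounded_linear_minus)

lift_definition zero_cblinfun :: "('a, 'b) cblinfun" is "\<lambda>_. 0"
  by simp

lift_definition plus_cblinfun :: "('a, 'b) cblinfun \<Rightarrow> ('a, 'b) cblinfun \<Rightarrow> ('a, 'b) cblinfun"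
  is "\<lambda>f g x. f x + g x"
  by (auto intro: bounded_linear_add simp: scaleC_add_right)

lift_definition scaleC_cblinfun :: "complex \<Rightarrow> ('a, 'b) cblinfun \<Rightarrow> ('a, 'b) cblinfun"
  is "\<lambda>c f x. c *\<^sub>C f x"
  by (auto intro: bounded_linear_compose[OF bounded_linear_scaleC] simp: scaleC_scaleC mult.commute)

lift_definition scaleR_cblinfun :: "real \<Rightarrow> ('a, 'b) cblinfun \<Rightarrow> ('a, 'b) cblinfun"
  is "\<lambda>r f x. r *\<^sub>R f x"
  by (auto intro: bounded_linear_compose[OF bounded_linear_scaleC]
      simp: scaleR_scaleC scaleC_scaleC mult.commute)

definition dist_cblinfun :: "('a, 'b) cblinfun \<Rightarrow> ('a, 'b) cblinfun \<Rightarrow> real"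
  where "dist_cblinfun A B = norm (A - B)"

definition uniformity_cblinfun :: "(('a, 'b) cblinfun \<times> ('a, 'b) cblinfun) filter"
  where "uniformity_cblinfun = (INF e\<in>{0<..}. principal {(x, y). dist x y < e})"

definition open_cblinfun :: "('a, 'b) cblinfun set \<Rightarrow> bool"
  where "open_cblinfun S \<longleftrightarrow> (\<forall>x\<in>S. \<forall>\<^sub>F (x', y) in uniformity. x' = x \<longrightarrow> y \<in> S)"

definition sgn_cblinfun :: "('a, 'b) cblinfun \<Rightarrow> ('a, 'b) cblinfun"
  where "sgn_cblinfun A = scaleR (inverse (norm A)) A"

instance
proof
  fix A B C :: "('a, 'b) cblinfun" and r s :: real and a b :: complex
  show "dist A B = norm (A - B)" by (rule dist_cblinfun_def)
  show "sgn A = inverse (norm A) *\<^sub>R A" by (rule sgn_cblinfun_def)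
  show "(uniformity :: (('a, 'b) cblinfun \<times> ('a, 'b) cblinfun) filter)
      = (INF e\<in>{0<..}. principal {(x, y). dist x y < e})"
    by (rule uniformity_cblinfun_def)
  show "open U \<longleftrightarrow> (\<forall>x\<in>U. \<forall>\<^sub>F (x', y) in uniformity. x' = x \<longrightarrow> y \<in> U)"
    for U :: "('a, 'b) cblinfun set"
    by (rule open_cblinfun_def)
  show "(norm A = 0) = (A = 0)" by transfer (auto simp: onorm_eq_0)
  show "norm (A + B) \<le> norm A + norm B" by transfer (auto simp: onorm_triangle)
  show "norm (r *\<^sub>R A) = \<bar>r\<bar> * norm A" by transfer (auto simp: onorm_scaleR)
  show "norm (a *\<^sub>C A) = cmod a * norm A"
  proof transfer
    fix a :: complex and f :: "'a \<Rightarrow> 'b"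
    assume "bounded_linear f \<and> (\<forall>c x. f (c *\<^sub>C x) = c *\<^sub>C f x)"
    then have bl: "bounded_linear f" by simp
    then have "onorm (\<lambda>x. cmod a *\<^sub>R f x) = cmod a * onorm f" by (simp add: onorm_scaleR)
    moreover have "onorm (\<lambda>x. cmod a *\<^sub>R f x) = onorm (\<lambda>x. a *\<^sub>C f x)"
      by (simp add: onorm_def norm_scaleC)
    ultimately show "onorm (\<lambda>x. a *\<^sub>C f x) = cmod a * onorm f" by simp
  qed
  show "A + B + C = A + (B + C)" by transfer (simp add: add.assoc)
  show "A + B = B + A" by transfer (simp add: add.commute)
  show "0 + A = A" "- A + A = 0" "A - B = A + - B" "1 *\<^sub>R A = A"
    by (transfer; simp)+
  show "r *\<^sub>R (A + B) = r *\<^sub>R A + r *\<^sub>R B" by transfer (simp add: scaleR_add_right)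
  show "(r + s) *\<^sub>R A = r *\<^sub>R A + s *\<^sub>R A" by transfer (simp add: scaleR_add_left)
  show "r *\<^sub>R s *\<^sub>R A = (r * s) *\<^sub>R A" by transfer simp
  show "a *\<^sub>C (A + B) = a *\<^sub>C A + a *\<^sub>C B" by transfer (simp add: scaleC_add_right)
  show "(a + b) *\<^sub>C A = a *\<^sub>C A + b *\<^sub>C A" by transfer (simp add: scaleC_add_left)
  show "a *\<^sub>C b *\<^sub>C A = (a * b) *\<^sub>C A" by transfer (simp add: scaleC_scaleC)
  show "r *\<^sub>R A = complex_of_real r *\<^sub>C A" by transfer (simp add: scaleR_scaleC)
qed

end

lemma norm_cblinfun: "norm (A *\<^sub>V x) \<le> norm A * norm x"
  by transfer (simp add: onorm)

lemma norm_cblinfun_bound: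
  "0 \<le> b \<Longrightarrow> (\<And>x. norm (A *\<^sub>V x) \<le> b * norm x) \<Longrightarrow> norm A \<le> b"
  by transfer (simp add: onorm_bound)

instance cblinfun :: (complex_normed_vector, "{complex_normed_vector, banach}") banach
proof
  fix X :: "nat \<Rightarrow> ('a, 'b) cblinfun"
  assume X: "Cauchy X"
  define Y where "Y n = Blinfun (cblinfun_apply (X n))" for n
  have Yapp: "blinfun_apply (Y n) = cblinfun_apply (X n)" for n
    unfolding Y_def by (simp add: bounded_linear_Blinfun_apply bounded_linear_cblinfun_apply)
  have nYX: "norm (Y m - Y n) = norm (X m - X n)" for m n
    by (simp add: norm_blinfun.rep_eq norm_cblinfun.rep_eq minus_blinfun.rep_eq
        minus_cblinfun.rep_eq Yapp)
  have "Cauchy Y" using X by (simp add: Cauchy_altdef dist_norm nYX)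
  then obtain L where L: "Y \<longlonglongrightarrow> L" using Cauchy_convergent convergent_def by blast
  have Lx: "(\<lambda>n. X n *\<^sub>V x) \<longlonglongrightarrow> blinfun_apply L x" for x
    using blinfun.tendsto[OF L tendsto_const[of x]] by (simp add: Yapp)
  have "blinfun_apply L (c *\<^sub>C x) = c *\<^sub>C blinfun_apply L x" for c x
  proof (rule LIMSEQ_unique)
    show "(\<lambda>n. X n *\<^sub>V (c *\<^sub>C x)) \<longlonglongrightarrow> blinfun_apply L (c *\<^sub>C x)" by (rule Lx)
    show "(\<lambda>n. X n *\<^sub>V (c *\<^sub>C x)) \<longlonglongrightarrow> c *\<^sub>C blinfun_apply L x"
      unfolding cblinfun_apply_scaleC
      by (rule bounded_linear.tendsto[OF bounded_linear_scaleC Lx])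
  qed
  then have Lapp: "cblinfun_apply (CBlinfun (blinfun_apply L)) = blinfun_apply L"
    by (intro CBlinfun_inverse) (simp add: blinfun.bounded_linear_right)
  have "norm (X n - CBlinfun (blinfun_apply L)) = norm (Y n - L)" for n
    by (simp add: norm_blinfun.rep_eq norm_cblinfun.rep_eq minus_blinfun.rep_eq
        minus_cblinfun.rep_eq Yapp Lapp)
  then have "X \<longlonglongrightarrow> CBlinfun (blinfun_apply L)"
    using L by (simp add: LIMSEQ_iff)
  then show "convergent X" by (auto simp: convergent_def)
qed

lift_definition cblinfun_compose ::
    "('b :: complex_normed_vector, 'c :: complex_normed_vector) cblinfun
      \<Rightarrow> ('a :: complex_normed_vector, 'b) cblinfun \<Rightarrow> ('a, 'c) cblinfun"
    (infixl "\<circ>\<^sub>C" 67)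
  is "\<lambda>f g x. f (g x)"
  by (auto intro: bounded_linear_compose)

definition cadjoint ::
    "('a :: chilbert_space, 'b :: chilbert_space) cblinfun \<Rightarrow> ('b, 'a) cblinfun" where
  "cadjoint A = (THE B. \<forall>x y. cinner (A *\<^sub>V x) y = cinner x (B *\<^sub>V y))"

lemma cadjoint_exists:
  fixes A :: "('a :: chilbert_space, 'b :: chilbert_space) cblinfun"
  shows "\<exists>B. \<forall>x y. cinner (A *\<^sub>V x) y = cinner x (B *\<^sub>V y)"
proof -
  have "\<exists>z. \<forall>x. cinner y (A *\<^sub>V x) = cinner z x" for y
    by (intro riesz_representation
        bounded_linear_compose[OF bounded_linear_cinner_right bounded_linear_cblinfun_apply])
      (simp add: cblinfun_apply_scaleC cinner_scaleC_right)
  then obtain g where g0: "\<And>y x. cinner y (A *\<^sub>V x) = cinner (g y) x" by metis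
  have g: "cinner (A *\<^sub>V x) y = cinner x (g y)" for x y
    using g0[of y x] cinner_commute[of "A *\<^sub>V x" y] cinner_commute[of x "g y"] by simp
  have gC: "g (c *\<^sub>C y) = c *\<^sub>C g y" for c y
    by (rule cinner_eqI) (simp flip: g add: cinner_scaleC_right)
  have bound: "norm (g y) \<le> norm y * norm A" for y
  proof (cases "g y = 0")
    case False
    have "(norm (g y))\<^sup>2 = cmod (cinner (g y) (g y))" by (simp add: cinner_self norm_power)
    also have "\<dots> = cmod (cinner (A *\<^sub>V g y) y)" by (simp add: g)
    also have "\<dots> \<le> norm (A *\<^sub>V g y) * norm y" by (rule norm_cinner_le)
    also have "\<dots> \<le> norm A * norm (g y) * norm y" by (intro mult_right_mono norm_cblinfun) simp
    finally have "norm (g y) * norm (g y) \<le> (norm y * norm A) * norm (g y)"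
      by (simp add: power2_eq_square mult_ac)
    then show ?thesis using False by simp
  qed simp
  have "bounded_linear g"
  proof (rule bounded_linear_intro)
    show "g (x + y) = g x + g y" for x y
      by (rule cinner_eqI) (simp flip: g add: cinner_add_right)
    show "g (r *\<^sub>R x) = r *\<^sub>R g x" for r x by (simp add: scaleR_scaleC gC)
  qed (rule bound)
  with gC have "cblinfun_apply (CBlinfun g) = g" by (intro CBlinfun_inverse) simp
  with g show ?thesis by (intro exI[of _ "CBlinfun g"]) simp
qed

lemma cinner_cadjoint_right: "cinner x (cadjoint A *\<^sub>V y) = cinner (A *\<^sub>V x) y"
proof -
  have "\<exists>!B. \<forall>x y. cinner (A *\<^sub>V x) y = cinner x (B *\<^sub>V y)"
  proof (rule ex_ex1I[OF cadjoint_exists])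
    fix B C
    assume "\<forall>x y. cinner (A *\<^sub>V x) y = cinner x (B *\<^sub>V y)"
      and "\<forall>x y. cinner (A *\<^sub>V x) y = cinner x (C *\<^sub>V y)"
    then have "cinner z (B *\<^sub>V y) = cinner z (C *\<^sub>V y)" for y z by metis
    then show "B = C" by (intro cblinfun_eqI cinner_eqI)
  qed
  from theI'[OF this, folded cadjoint_def] show ?thesis by simp
qed

lemma cinner_cadjoint_left: "cinner (cadjoint A *\<^sub>V x) y = cinner x (A *\<^sub>V y)"
proof -
  have "cinner (cadjoint A *\<^sub>V x) y = cnj (cinner y (cadjoint A *\<^sub>V x))" by (rule cinner_commute)
  also have "\<dots> = cnj (cinner (A *\<^sub>V y) x)" by (simp only: cinner_cadjoint_right)
  also have "\<dots> = cinner x (A *\<^sub>V y)" by (rule cinner_commute[symmetric])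
  finally show ?thesis .
qed


section \<open>Hilbert-Schmidt operators\<close>

text \<open>
  The trace is computed in an arbitrarily chosen orthonormal basis; one exists by
  \<open>orthonormal_basis_exists\<close>, and for positive or trace-class operators, the only ones to
  which it is applied below, the value does not depend on it.  The diagonal entries of \<open>A\<^sup>* A\<close> are non-negative, so
  their summability is what \<open>tr (A\<^sup>* A) < \<infinity>\<close> means.
\<close>

definition some_onb :: "'a :: chilbert_space set" where
  "some_onb = (SOME E. orthonormal_basis (\<lambda>e. e) E)"

definition trace :: "('a :: chilbert_space, 'a) cblinfun \<Rightarrow> complex" where
  "trace T = (\<Sum>\<^sub>\<infinity>e\<in>some_onb. cinner e (T *\<^sub>V e))"

definition hilbert_schmidt :: "('a :: chilbert_space, 'b :: chilbert_space) cblinfun \<Rightarrow> bool" where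
  "hilbert_schmidt A \<longleftrightarrow> (\<lambda>e. cinner e ((cadjoint A \<circ>\<^sub>C A) *\<^sub>V e)) summable_on some_onb"

lemma orthonormal_basis_some_onb:
  "orthonormal_basis (\<lambda>e. e) (some_onb :: 'a :: chilbert_space set)"
  unfolding some_onb_def by (rule someI_ex) (rule orthonormal_basis_exists)

lemma cinner_cadjoint_compose:
  "cinner x ((cadjoint A \<circ>\<^sub>C B) *\<^sub>V y) = cinner (A *\<^sub>V x) (B *\<^sub>V y)"
  by (simp add: cblinfun_compose.rep_eq cinner_cadjoint_right)

lemma hilbert_schmidt_iff:
  "hilbert_schmidt A \<longleftrightarrow> (\<lambda>e. (norm (A *\<^sub>V e))\<^sup>2) summable_on some_onb"
proof
  assume "hilbert_schmidt A"
  then show "(\<lambda>e. (norm (A *\<^sub>V e))\<^sup>2) summable_on some_onb"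
    unfolding hilbert_schmidt_def cinner_cadjoint_compose cinner_self
    by (drule_tac summable_on_Re) simp
next
  assume "(\<lambda>e. (norm (A *\<^sub>V e))\<^sup>2) summable_on some_onb"
  then show "hilbert_schmidt A"
    unfolding hilbert_schmidt_def cinner_cadjoint_compose cinner_self by (rule summable_on_of_real)
qed

lemma hilbert_schmidt_zero: "hilbert_schmidt 0"
  by (simp add: hilbert_schmidt_iff zero_cblinfun.rep_eq)

lemma hilbert_schmidt_scaleC: "hilbert_schmidt A \<Longrightarrow> hilbert_schmidt (c *\<^sub>C A)"
  by (simp add: hilbert_schmidt_iff scaleC_cblinfun.rep_eq norm_scaleC power_mult_distrib
      summable_on_cmult_right)

lemma hilbert_schmidt_add:
  assumes "hilbert_schmidt A" "hilbert_schmidt B"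
  shows "hilbert_schmidt (A + B)"
  unfolding hilbert_schmidt_iff
proof (rule summable_on_comparison_test)
  show "(\<lambda>e. 2 * (norm (A *\<^sub>V e))\<^sup>2 + 2 * (norm (B *\<^sub>V e))\<^sup>2) summable_on some_onb"
    using assms by (intro summable_on_add summable_on_cmult_right) (simp_all add: hilbert_schmidt_iff)
  show "(norm ((A + B) *\<^sub>V e))\<^sup>2 \<le> 2 * (norm (A *\<^sub>V e))\<^sup>2 + 2 * (norm (B *\<^sub>V e))\<^sup>2" for e
  proof -
    have "(norm ((A + B) *\<^sub>V e))\<^sup>2 \<le> (norm (A *\<^sub>V e) + norm (B *\<^sub>V e))\<^sup>2"
      by (intro power_mono) (simp_all add: plus_cblinfun.rep_eq norm_triangle_ineq)
    also have "\<dots> \<le> 2 * (norm (A *\<^sub>V e))\<^sup>2 + 2 * (norm (B *\<^sub>V e))\<^sup>2"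
      using zero_le_power2[of "norm (A *\<^sub>V e) - norm (B *\<^sub>V e)"]
      unfolding power2_sum power2_diff by linarith
    finally show ?thesis .
  qed
qed simp

lemma hilbert_schmidt_scaleR: "hilbert_schmidt A \<Longrightarrow> hilbert_schmidt (r *\<^sub>R A)"
  by (simp add: scaleR_scaleC hilbert_schmidt_scaleC)

lemma hilbert_schmidt_uminus: "hilbert_schmidt A \<Longrightarrow> hilbert_schmidt (- A)"
  using hilbert_schmidt_scaleR[of A "-1"] by simp

lemma hilbert_schmidt_diff: "hilbert_schmidt A \<Longrightarrow> hilbert_schmidt B \<Longrightarrow> hilbert_schmidt (A - B)"
  using hilbert_schmidt_add[of A "- B"] by (simp add: hilbert_schmidt_uminus)

lemma trace_cadjoint_compose:
  "trace (cadjoint A \<circ>\<^sub>C B) = (\<Sum>\<^sub>\<infinity>e\<in>some_onb. cinner (A *\<^sub>V e) (B *\<^sub>V e))"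
  by (simp add: trace_def cinner_cadjoint_compose)

lemma hilbert_schmidt_cinner_summable:
  assumes "hilbert_schmidt A" "hilbert_schmidt B"
  shows "(\<lambda>e. cinner (A *\<^sub>V e) (B *\<^sub>V e)) summable_on some_onb"
  unfolding summable_on_iff_abs_summable_on_complex
proof (rule summable_on_comparison_test)
  show "(\<lambda>e. (norm (A *\<^sub>V e))\<^sup>2 + (norm (B *\<^sub>V e))\<^sup>2) summable_on some_onb"
    using assms by (intro summable_on_add) (simp_all add: hilbert_schmidt_iff)
  show "cmod (cinner (A *\<^sub>V e) (B *\<^sub>V e)) \<le> (norm (A *\<^sub>V e))\<^sup>2 + (norm (B *\<^sub>V e))\<^sup>2" for e
  proof -
    have "2 * (norm (A *\<^sub>V e) * norm (B *\<^sub>V e)) \<le> (norm (A *\<^sub>V e))\<^sup>2 + (norm (B *\<^sub>V e))\<^sup>2"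
      using sum_squares_bound[of "norm (A *\<^sub>V e)" "norm (B *\<^sub>V e)"] by simp
    moreover have "0 \<le> norm (A *\<^sub>V e) * norm (B *\<^sub>V e)" by simp
    ultimately show ?thesis
      using norm_cinner_le[of "A *\<^sub>V e" "B *\<^sub>V e"] by linarith
  qed
qed simp

lemma norm_le_hilbert_schmidt:
  assumes "hilbert_schmidt A"
  shows "norm A \<le> sqrt (\<Sum>\<^sub>\<infinity>e\<in>some_onb. (norm (A *\<^sub>V e))\<^sup>2)" (is "_ \<le> ?K")
proof (rule norm_cblinfun_bound)
  have sm: "(\<lambda>e. (norm (A *\<^sub>V e))\<^sup>2) summable_on some_onb"
    using assms by (simp add: hilbert_schmidt_iff)
  show "?K \<ge> 0" by (simp add: infsum_nonneg)
  fix x :: 'a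
  define C where "C = {x. norm (A *\<^sub>V x) \<le> ?K * norm x}"
  have "closed C" unfolding C_def
    by (intro closed_Collect_le continuous_intros
        bounded_linear.continuous_on[OF bounded_linear_cblinfun_apply])
  moreover have "cspan some_onb \<subseteq> C"
  proof
    fix y :: 'a assume "y \<in> cspan some_onb"
    then obtain F c where F: "finite F" "F \<subseteq> some_onb" and y: "y = (\<Sum>e\<in>F. c e *\<^sub>C e)"
      unfolding complex_vector.span_explicit by auto
    have on: "cinner e f = (if e = f then 1 else 0)" if "e \<in> F" "f \<in> F" for e f
      using orthonormal_basis_some_onb that F(2) unfolding orthonormal_basis_def by blast
    have ey: "cinner e y = c e" if e: "e \<in> F" for e
    proof -
      have "cinner e y = (\<Sum>f\<in>F. c f * cinner e f)"
        unfolding y cinner_sum_right cinner_scaleC_right ..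
      also have "\<dots> = (\<Sum>f\<in>F. if e = f then c f else 0)"
        using e by (intro sum.cong) (auto simp: on)
      also have "\<dots> = c e" using e F(1) by simp
      finally show ?thesis .
    qed
    have "cinner y y = cinner (\<Sum>e\<in>F. c e *\<^sub>C e) y" by (simp only: y)
    also have "\<dots> = (\<Sum>e\<in>F. cnj (c e) * c e)"
      by (simp add: cinner_sum_left cinner_scaleC_left ey)
    also have "\<dots> = complex_of_real (\<Sum>e\<in>F. (cmod (c e))\<^sup>2)"
      by (simp only: of_real_sum complex_norm_square mult.commute)
    finally have ny: "(norm y)\<^sup>2 = (\<Sum>e\<in>F. (cmod (c e))\<^sup>2)"
      by (simp only: cinner_self of_real_eq_iff)
    have "A *\<^sub>V y = (\<Sum>e\<in>F. c e *\<^sub>C (A *\<^sub>V e))"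
      unfolding y linear_sum[OF bounded_linear.linear[OF bounded_linear_cblinfun_apply]]
      by (simp add: cblinfun_apply_scaleC)
    then have "norm (A *\<^sub>V y) \<le> (\<Sum>e\<in>F. norm (A *\<^sub>V e) * cmod (c e))"
      by (auto intro!: order_trans[OF norm_sum] sum_mono simp: norm_scaleC mult.commute)
    then have "(norm (A *\<^sub>V y))\<^sup>2 \<le> (\<Sum>e\<in>F. norm (A *\<^sub>V e) * cmod (c e))\<^sup>2"
      by (rule power_mono) simp
    also have "\<dots> \<le> (\<Sum>e\<in>F. (norm (A *\<^sub>V e))\<^sup>2) * (\<Sum>e\<in>F. (cmod (c e))\<^sup>2)"
      by (rule Cauchy_Schwarz_ineq_sum)
    also have "\<dots> \<le> ?K\<^sup>2 * (norm y)\<^sup>2"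
      unfolding ny using F
      by (intro mult_right_mono sum_nonneg) (auto intro!: finite_sum_le_infsum sm simp: infsum_nonneg)
    finally have "(norm (A *\<^sub>V y))\<^sup>2 \<le> (?K * norm y)\<^sup>2" by (simp add: power_mult_distrib)
    then show "y \<in> C"
      unfolding C_def by (auto intro!: power2_le_imp_le mult_nonneg_nonneg simp: infsum_nonneg)
  qed
  ultimately have "closure (cspan some_onb) \<subseteq> C" by (rule closure_minimal[rotated])
  then have "x \<in> C" using orthonormal_basis_some_onb unfolding orthonormal_basis_def by auto
  then show "norm (A *\<^sub>V x) \<le> ?K * norm x" by (simp add: C_def)
qed


subsection \<open>The Hilbert space of Hilbert-Schmidt operators\<close>

typedef (overloaded) ('a, 'b) hs =
  "{A :: ('a :: chilbert_space, 'b :: chilbert_space) cblinfun. hilbert_schmidt A}"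
  morphisms cblinfun_of_hs hs_of_cblinfun
  using hilbert_schmidt_zero by blast

setup_lifting type_definition_hs

lemma hs_cinner_summable:
  "(\<lambda>e. cinner (cblinfun_of_hs A *\<^sub>V e) (cblinfun_of_hs B *\<^sub>V e)) summable_on some_onb"
  using cblinfun_of_hs by (intro hilbert_schmidt_cinner_summable) auto

instantiation hs :: (chilbert_space, chilbert_space) real_inner
begin

lift_definition zero_hs :: "('a, 'b) hs" is 0 by (rule hilbert_schmidt_zero)
lift_definition plus_hs :: "('a, 'b) hs \<Rightarrow> ('a, 'b) hs \<Rightarrow> ('a, 'b) hs" is "(+)"
  by (rule hilbert_schmidt_add)
lift_definition minus_hs :: "('a, 'b) hs \<Rightarrow> ('a, 'b) hs \<Rightarrow> ('a, 'b) hs" is "(-)"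
  by (rule hilbert_schmidt_diff)
lift_definition uminus_hs :: "('a, 'b) hs \<Rightarrow> ('a, 'b) hs" is uminus
  by (rule hilbert_schmidt_uminus)
lift_definition scaleR_hs :: "real \<Rightarrow> ('a, 'b) hs \<Rightarrow> ('a, 'b) hs" is scaleR
  by (rule hilbert_schmidt_scaleR)

lift_definition inner_hs :: "('a, 'b) hs \<Rightarrow> ('a, 'b) hs \<Rightarrow> real"
  is "\<lambda>A B. Re (trace (cadjoint A \<circ>\<^sub>C B))" .

definition norm_hs :: "('a, 'b) hs \<Rightarrow> real" where "norm_hs A = sqrt (inner A A)"

definition dist_hs :: "('a, 'b) hs \<Rightarrow> ('a, 'b) hs \<Rightarrow> real" where "dist_hs A B = norm (A - B)"

definition uniformity_hs :: "(('a, 'b) hs \<times> ('a, 'b) hs) filter"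
  where "uniformity_hs = (INF e\<in>{0<..}. principal {(x, y). dist x y < e})"

definition open_hs :: "('a, 'b) hs set \<Rightarrow> bool"
  where "open_hs S \<longleftrightarrow> (\<forall>x\<in>S. \<forall>\<^sub>F (x', y) in uniformity. x' = x \<longrightarrow> y \<in> S)"

definition sgn_hs :: "('a, 'b) hs \<Rightarrow> ('a, 'b) hs" where "sgn_hs A = inverse (norm A) *\<^sub>R A"

lemma inner_hs_infsum:
  "inner A B = (\<Sum>\<^sub>\<infinity>e\<in>some_onb. inner (cblinfun_of_hs A *\<^sub>V e) (cblinfun_of_hs B *\<^sub>V e))"
  unfolding inner_hs.rep_eq trace_cadjoint_compose inner_eq_Re_cinner
  by (rule infsum_Re[symmetric]) (rule hs_cinner_summable)

lemma hs_inner_summable: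
  "(\<lambda>e. inner (cblinfun_of_hs A *\<^sub>V e) (cblinfun_of_hs B *\<^sub>V e)) summable_on some_onb"
  unfolding inner_eq_Re_cinner by (rule summable_on_Re) (rule hs_cinner_summable)

instance
proof
  fix A B C :: "('a, 'b) hs" and r s :: real
  show "A + B + C = A + (B + C)" "A + B = B + A" "0 + A = A" "- A + A = 0" "A - B = A + - B"
    "1 *\<^sub>R A = A" "r *\<^sub>R (A + B) = r *\<^sub>R A + r *\<^sub>R B" "(r + s) *\<^sub>R A = r *\<^sub>R A + s *\<^sub>R A"
    "r *\<^sub>R s *\<^sub>R A = (r * s) *\<^sub>R A"
    by (transfer, simp add: algebra_simps)+
  show "dist A B = norm (A - B)" by (rule dist_hs_def)
  show "sgn A = inverse (norm A) *\<^sub>R A" by (rule sgn_hs_def)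
  show "(uniformity :: (('a, 'b) hs \<times> ('a, 'b) hs) filter)
      = (INF e\<in>{0<..}. principal {(x, y). dist x y < e})"
    by (rule uniformity_hs_def)
  show "open U \<longleftrightarrow> (\<forall>x\<in>U. \<forall>\<^sub>F (x', y) in uniformity. x' = x \<longrightarrow> y \<in> U)"
    for U :: "('a, 'b) hs set"
    by (rule open_hs_def)
  show "norm A = sqrt (inner A A)" by (rule norm_hs_def)
  show "inner A B = inner B A"
    unfolding inner_hs_infsum by (intro infsum_cong) (rule inner_commute)
  show "inner (A + B) C = inner A C + inner B C"
    unfolding inner_hs_infsum plus_hs.rep_eq plus_cblinfun.rep_eq inner_add_left
    by (intro infsum_add hs_inner_summable)
  show "inner (r *\<^sub>R A) B = r * inner A B"
    unfolding inner_hs_infsum scaleR_hs.rep_eq scaleR_cblinfun.rep_eq inner_scaleR_left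
    by (rule infsum_cmult_right) (rule hs_inner_summable)
  show "0 \<le> inner A A"
    unfolding inner_hs_infsum by (rule infsum_nonneg) simp
  show "inner A A = 0 \<longleftrightarrow> A = 0"
  proof
    assume "inner A A = 0"
    then have "norm (cblinfun_of_hs A) \<le> 0"
      using norm_le_hilbert_schmidt[of "cblinfun_of_hs A"] cblinfun_of_hs[of A]
      by (simp add: inner_hs_infsum power2_norm_eq_inner)
    then show "A = 0" by transfer simp
  qed (simp add: inner_hs_infsum zero_hs.rep_eq zero_cblinfun.rep_eq)
qed

end

instantiation hs :: (chilbert_space, chilbert_space) complex_inner
begin

lift_definition scaleC_hs :: "complex \<Rightarrow> ('a, 'b) hs \<Rightarrow> ('a, 'b) hs" is scaleC
  by (rule hilbert_schmidt_scaleC)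

lift_definition cinner_hs :: "('a, 'b) hs \<Rightarrow> ('a, 'b) hs \<Rightarrow> complex"
  is "\<lambda>A B. trace (cadjoint A \<circ>\<^sub>C B)" .

lemma cinner_hs_infsum:
  "cinner A B = (\<Sum>\<^sub>\<infinity>e\<in>some_onb. cinner (cblinfun_of_hs A *\<^sub>V e) (cblinfun_of_hs B *\<^sub>V e))"
  unfolding cinner_hs.rep_eq trace_cadjoint_compose ..

instance
proof
  fix A B C :: "('a, 'b) hs" and r :: real and a b :: complex
  show "a *\<^sub>C (A + B) = a *\<^sub>C A + a *\<^sub>C B" by transfer (rule scaleC_add_right)
  show "(a + b) *\<^sub>C A = a *\<^sub>C A + b *\<^sub>C A" by transfer (rule scaleC_add_left)
  show "a *\<^sub>C b *\<^sub>C A = (a * b) *\<^sub>C A" by transfer (rule scaleC_scaleC)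
  show "r *\<^sub>R A = complex_of_real r *\<^sub>C A" by transfer (rule scaleR_scaleC)
  show "inner A B = Re (cinner A B)" by transfer (rule refl)
  have sc: "inner (a *\<^sub>C A) (a *\<^sub>C A) = (cmod a)\<^sup>2 * inner A A"
    unfolding inner_hs_infsum scaleC_hs.rep_eq scaleC_cblinfun.rep_eq
    by (subst infsum_cmult_right[OF hs_inner_summable, symmetric])
      (simp add: norm_scaleC power_mult_distrib flip: power2_norm_eq_inner)
  then show "norm (a *\<^sub>C A) = cmod a * norm A"
    by (simp add: norm_eq_sqrt_inner real_sqrt_mult)
  show "cinner A B = cnj (cinner B A)"
    unfolding cinner_hs_infsum infsum_cnj[symmetric] by (intro infsum_cong) (rule cinner_commute)
  show "cinner A (B + C) = cinner A B + cinner A C"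
    unfolding cinner_hs_infsum plus_hs.rep_eq plus_cblinfun.rep_eq cinner_add_right
    by (intro infsum_add hs_cinner_summable)
  show "cinner A (a *\<^sub>C B) = a * cinner A B"
    unfolding cinner_hs_infsum scaleC_hs.rep_eq scaleC_cblinfun.rep_eq cinner_scaleC_right
    by (rule infsum_cmult_right) (rule hs_cinner_summable)
qed

end

lemma norm_hs_infsum:
  "(norm A)\<^sup>2 = (\<Sum>\<^sub>\<infinity>e\<in>some_onb. (norm (cblinfun_of_hs A *\<^sub>V e))\<^sup>2)"
  by (simp add: power2_norm_eq_inner inner_hs_infsum)

lemma norm_cblinfun_of_hs: "norm (cblinfun_of_hs A) \<le> norm A"
  using norm_le_hilbert_schmidt[of "cblinfun_of_hs A"] cblinfun_of_hs[of A]
  by (simp flip: norm_hs_infsum)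

instance hs :: (chilbert_space, chilbert_space) chilbert_space
proof
  fix X :: "nat \<Rightarrow> ('a, 'b) hs"
  assume X: "Cauchy X"
  define Y where "Y n = cblinfun_of_hs (X n)" for n
  have YX: "norm (Y m - Y n) \<le> norm (X m - X n)" for m n
    unfolding Y_def by (metis minus_hs.rep_eq norm_cblinfun_of_hs)
  have "Cauchy Y"
  proof (rule CauchyI)
    fix e :: real assume "e > 0"
    then obtain N where "\<And>m n. m \<ge> N \<Longrightarrow> n \<ge> N \<Longrightarrow> norm (X m - X n) < e"
      using CauchyD[OF X] by blast
    then show "\<exists>N. \<forall>m\<ge>N. \<forall>n\<ge>N. norm (Y m - Y n) < e"
      using YX by (meson le_less_trans)
  qed
  then obtain L where L: "Y \<longlonglongrightarrow> L" using Cauchy_convergent convergent_def by blast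
  have pw: "(\<lambda>n. Y n *\<^sub>V x) \<longlonglongrightarrow> L *\<^sub>V x" for x
  proof -
    have "(\<lambda>n. norm (Y n - L) * norm x) \<longlonglongrightarrow> 0"
      using tendsto_mult_left_zero[OF tendsto_norm_zero[OF LIM_zero[OF L]], of "norm x"] .
    moreover have "norm (Y n *\<^sub>V x - L *\<^sub>V x) \<le> norm (Y n - L) * norm x" for n
      using norm_cblinfun[of "Y n - L" x] by (simp add: minus_cblinfun.rep_eq)
    ultimately have "(\<lambda>n. Y n *\<^sub>V x - L *\<^sub>V x) \<longlonglongrightarrow> 0"
      by (rule Lim_null_comparison[rotated, OF _ always_eventually[OF allI]])
    then show ?thesis by (rule LIM_zero_cancel)
  qed
  have est: "(\<Sum>e\<in>F. (norm ((Y n - L) *\<^sub>V e))\<^sup>2) \<le> \<epsilon>\<^sup>2"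
    if N: "\<And>m. m \<ge> N \<Longrightarrow> norm (X n - X m) \<le> \<epsilon>" and F: "finite F" "F \<subseteq> some_onb" for F n N \<epsilon>
  proof (rule tendsto_upperbound)
    show "(\<lambda>m. \<Sum>e\<in>F. (norm ((Y n - Y m) *\<^sub>V e))\<^sup>2) \<longlonglongrightarrow> (\<Sum>e\<in>F. (norm ((Y n - L) *\<^sub>V e))\<^sup>2)"
      unfolding minus_cblinfun.rep_eq by (intro tendsto_intros pw)
    have "(\<Sum>e\<in>F. (norm ((Y n - Y m) *\<^sub>V e))\<^sup>2) \<le> \<epsilon>\<^sup>2" if "m \<ge> N" for m
    proof -
      have "(\<Sum>e\<in>F. (norm ((Y n - Y m) *\<^sub>V e))\<^sup>2)
          \<le> (\<Sum>\<^sub>\<infinity>e\<in>some_onb. (norm (cblinfun_of_hs (X n - X m) *\<^sub>V e))\<^sup>2)"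
        unfolding Y_def minus_hs.rep_eq[symmetric]
        using F cblinfun_of_hs[of "X n - X m"]
        by (intro finite_sum_le_infsum) (auto simp: hilbert_schmidt_iff)
      also have "\<dots> = (norm (X n - X m))\<^sup>2" by (rule norm_hs_infsum[symmetric])
      also have "\<dots> \<le> \<epsilon>\<^sup>2" using N[OF that] by (intro power_mono) auto
      finally show ?thesis .
    qed
    then show "\<forall>\<^sub>F m in sequentially. (\<Sum>e\<in>F. (norm ((Y n - Y m) *\<^sub>V e))\<^sup>2) \<le> \<epsilon>\<^sup>2"
      by (auto simp: eventually_sequentially)
  qed simp
  have hs: "hilbert_schmidt (Y n - L)" if N: "\<And>m. m \<ge> N \<Longrightarrow> norm (X n - X m) \<le> \<epsilon>" for n N \<epsilon>
    unfolding hilbert_schmidt_iff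
    by (intro nonneg_bdd_above_summable_on bdd_aboveI2[where M = "\<epsilon>\<^sup>2"]) (auto intro: est[OF N])
  have ev: "\<exists>N. \<forall>n\<ge>N. \<forall>m\<ge>N. norm (X n - X m) \<le> \<epsilon>" if "\<epsilon> > 0" for \<epsilon>
    using CauchyD[OF X that] less_imp_le by blast
  obtain N1 where "\<And>m. m \<ge> N1 \<Longrightarrow> norm (X N1 - X m) \<le> 1" using ev[of 1] by auto
  then have "hilbert_schmidt (Y N1 - L)" by (rule hs)
  moreover have "hilbert_schmidt (Y N1)" using cblinfun_of_hs by (auto simp: Y_def)
  ultimately have "hilbert_schmidt (Y N1 - (Y N1 - L))" by (rule hilbert_schmidt_diff[rotated])
  then have "hilbert_schmidt L" by simp
  then obtain Z where Z: "L = cblinfun_of_hs Z" using cblinfun_of_hs_cases by blast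
  have "X \<longlonglongrightarrow> Z"
  proof (rule metric_LIMSEQ_I)
    fix r :: real assume r: "r > 0"
    then obtain N where N: "\<And>n m. n \<ge> N \<Longrightarrow> m \<ge> N \<Longrightarrow> norm (X n - X m) \<le> r / 2"
      using ev[of "r / 2"] by auto
    have "dist (X n) Z < r" if n: "n \<ge> N" for n
    proof -
      have "(norm (X n - Z))\<^sup>2 \<le> (r / 2)\<^sup>2"
        unfolding norm_hs_infsum minus_hs.rep_eq Z[symmetric] Y_def[symmetric]
      proof (rule infsum_le_finite_sums)
        show "(\<lambda>e. (norm ((Y n - L) *\<^sub>V e))\<^sup>2) summable_on some_onb"
          using hs[OF N[OF n]] by (simp only: hilbert_schmidt_iff)
      qed (rule est[OF N[OF n]])
      then have "norm (X n - Z) \<le> r / 2" by (rule power2_le_imp_le) (use r in simp)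
      then show ?thesis using r by (simp add: dist_norm)
    qed
    then show "\<exists>N. \<forall>n\<ge>N. dist (X n) Z < r" by blast
  qed
  then show "convergent X" by (auto simp: convergent_def)
qed

section \<open>Hilbert space tensor products\<close>

text \<open>
  A Hilbert space together with a bilinear map \<open>\<otimes>\<close> is a tensor product of two Hilbert spaces
  if \<open>\<langle>a \<otimes> b, a' \<otimes> b'\<rangle> = \<langle>a, a'\<rangle> \<langle>b, b'\<rangle>\<close> and the elementary tensors are total.  These
  conditions say that the algebraic tensor product, with its usual inner product, embeds
  isometrically and densely, i.e. that the space is its completion; this determines it up to a
  unique unitary commuting with \<open>\<otimes>\<close>.
\<close>

locale hilbert_tensor_product =
  fixes tensor :: "'a :: chilbert_space \<Rightarrow> 'b :: chilbert_space \<Rightarrow> 'c :: chilbert_space"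
    (infixl "\<otimes>" 75)
  assumes tensor_add_left: "(a + a') \<otimes> b = a \<otimes> b + a' \<otimes> b"
    and tensor_add_right: "a \<otimes> (b + b') = a \<otimes> b + a \<otimes> b'"
    and tensor_scaleC_left: "(c *\<^sub>C a) \<otimes> b = c *\<^sub>C (a \<otimes> b)"
    and tensor_scaleC_right: "a \<otimes> (c *\<^sub>C b) = c *\<^sub>C (a \<otimes> b)"
    and cinner_tensor: "cinner (a \<otimes> b) (a' \<otimes> b') = cinner a a' * cinner b b'"
    and tensor_total: "closure (cspan {a \<otimes> b | a b. True}) = UNIV"

section \<open>C*-algebras\<close>

locale cstar_algebra =
  fixes mult :: "'a :: {complex_normed_vector, banach} \<Rightarrow> 'a \<Rightarrow> 'a" (infixl "\<cdot>" 70)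
    and star :: "'a \<Rightarrow> 'a"
  assumes mult_assoc: "(x \<cdot> y) \<cdot> z = x \<cdot> (y \<cdot> z)"
    and mult_add_left: "(x + y) \<cdot> z = x \<cdot> z + y \<cdot> z"
    and mult_add_right: "x \<cdot> (y + z) = x \<cdot> y + x \<cdot> z"
    and mult_scaleC_left: "(c *\<^sub>C x) \<cdot> y = c *\<^sub>C (x \<cdot> y)"
    and mult_scaleC_right: "x \<cdot> (c *\<^sub>C y) = c *\<^sub>C (x \<cdot> y)"
    and norm_mult_le: "norm (x \<cdot> y) \<le> norm x * norm y"
    and star_add: "star (x + y) = star x + star y"
    and star_scaleC: "star (c *\<^sub>C x) = cnj c *\<^sub>C star x"
    and star_mult: "star (x \<cdot> y) = star y \<cdot> star x"
    and star_star: "star (star x) = x"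
    and norm_star_mult: "norm (star x \<cdot> x) = (norm x)\<^sup>2"

text \<open>A bijective *-homomorphism is automatically isometric; \<open>norm_hom\<close> records that the norm is
  part of the structure.\<close>

locale cstar_isomorphism =
  dom: cstar_algebra mult star + cod: cstar_algebra mult' star'
  for mult :: "'a :: {complex_normed_vector, banach} \<Rightarrow> 'a \<Rightarrow> 'a" and star
    and mult' :: "'b :: {complex_normed_vector, banach} \<Rightarrow> 'b \<Rightarrow> 'b" and star' +
  fixes h :: "'a \<Rightarrow> 'b"
  assumes bij_hom: "bij h"
    and hom_add: "h (x + y) = h x + h y"
    and hom_scaleC: "h (c *\<^sub>C x) = c *\<^sub>C h x"
    and hom_mult: "h (mult x y) = mult' (h x) (h y)"
    and hom_star: "h (star x) = star' (h x)"
    and norm_hom: "norm (h x) = norm x"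

lemma cstar_algebra_cblinfun:
  "cstar_algebra (cblinfun_compose :: ('h :: chilbert_space, 'h) cblinfun \<Rightarrow> _) cadjoint"
proof
  fix A B C :: "('h, 'h) cblinfun" and c :: complex
  have adj_eqI: "cadjoint S = T"
    if "\<And>x y. cinner (S *\<^sub>V x) y = cinner x (T *\<^sub>V y)" for S T :: "('h, 'h) cblinfun"
    by (intro cblinfun_eqI cinner_eqI) (simp add: cinner_cadjoint_right that)
  have compose_le: "norm (S \<circ>\<^sub>C T) \<le> norm S * norm T" for S T :: "('h, 'h) cblinfun"
    unfolding norm_cblinfun.rep_eq cblinfun_compose.rep_eq
    using onorm_compose[OF bounded_linear_cblinfun_apply bounded_linear_cblinfun_apply, of S T]
    by (simp add: o_def)
  show "A \<circ>\<^sub>C B \<circ>\<^sub>C C = A \<circ>\<^sub>C (B \<circ>\<^sub>C C)" by transfer simp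
  show "(A + B) \<circ>\<^sub>C C = A \<circ>\<^sub>C C + B \<circ>\<^sub>C C" by transfer simp
  show "A \<circ>\<^sub>C (B + C) = A \<circ>\<^sub>C B + A \<circ>\<^sub>C C"
    by (rule cblinfun_eqI)
      (simp add: cblinfun_compose.rep_eq plus_cblinfun.rep_eq cblinfun_apply_add)
  show "c *\<^sub>C A \<circ>\<^sub>C B = c *\<^sub>C (A \<circ>\<^sub>C B)" by transfer simp
  show "A \<circ>\<^sub>C c *\<^sub>C B = c *\<^sub>C (A \<circ>\<^sub>C B)" by transfer simp
  show "norm (A \<circ>\<^sub>C B) \<le> norm A * norm B" by (rule compose_le)
  show "cadjoint (A + B) = cadjoint A + cadjoint B"
    by (rule adj_eqI) (simp add: plus_cblinfun.rep_eq cinner_add_left cinner_add_right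
        cinner_cadjoint_right)
  show "cadjoint (c *\<^sub>C A) = cnj c *\<^sub>C cadjoint A"
    by (rule adj_eqI) (simp add: scaleC_cblinfun.rep_eq cinner_scaleC_left cinner_scaleC_right
        cinner_cadjoint_right)
  show "cadjoint (A \<circ>\<^sub>C B) = cadjoint B \<circ>\<^sub>C cadjoint A"
    by (rule adj_eqI) (simp add: cblinfun_compose.rep_eq cinner_cadjoint_right)
  show adj_adj: "cadjoint (cadjoint A) = A" for A :: "('h, 'h) cblinfun"
    by (rule adj_eqI) (simp add: cinner_cadjoint_left)
  have le: "(norm A)\<^sup>2 \<le> norm (cadjoint A \<circ>\<^sub>C A)" for A :: "('h, 'h) cblinfun"
  proof -
    have "norm A \<le> sqrt (norm (cadjoint A \<circ>\<^sub>C A))"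
    proof (rule norm_cblinfun_bound)
      fix x
      have "(norm (A *\<^sub>V x))\<^sup>2 = cmod (cinner x ((cadjoint A \<circ>\<^sub>C A) *\<^sub>V x))"
        by (simp add: cinner_cadjoint_compose cinner_self norm_power)
      also have "\<dots> \<le> norm x * norm ((cadjoint A \<circ>\<^sub>C A) *\<^sub>V x)" by (rule norm_cinner_le)
      also have "\<dots> \<le> norm x * (norm (cadjoint A \<circ>\<^sub>C A) * norm x)"
        by (intro mult_left_mono norm_cblinfun) simp
      also have "\<dots> = (sqrt (norm (cadjoint A \<circ>\<^sub>C A)) * norm x)\<^sup>2"
        by (simp add: power_mult_distrib) (simp add: power2_eq_square)
      finally show "norm (A *\<^sub>V x) \<le> sqrt (norm (cadjoint A \<circ>\<^sub>C A)) * norm x"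
        by (rule power2_le_imp_le) simp
    qed simp
    then have "(norm A)\<^sup>2 \<le> (sqrt (norm (cadjoint A \<circ>\<^sub>C A)))\<^sup>2" by (rule power_mono) simp
    then show ?thesis by simp
  qed
  have adj_le: "norm A \<le> norm (cadjoint A)" for A :: "('h, 'h) cblinfun"
  proof (cases "norm A = 0")
    case False
    have "norm A * norm A \<le> norm (cadjoint A) * norm A"
      using order_trans[OF le compose_le, of A] by (simp add: power2_eq_square)
    then show ?thesis using False by (simp add: mult_le_cancel_right)
  qed simp
  have "norm (cadjoint A \<circ>\<^sub>C A) \<le> (norm A)\<^sup>2"
    using compose_le[of "cadjoint A" A] adj_le[of "cadjoint A"]
    by (simp add: adj_adj power2_eq_square) (meson mult_right_mono norm_ge_zero order_trans)
  with le show "norm (cadjoint A \<circ>\<^sub>C A) = (norm A)\<^sup>2" by (intro antisym)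
qed

section \<open>Transporting operators between the two spaces\<close>

text \<open>
  \<open>\<phi>\<close> and \<open>\<psi>\<close> are orthonormal bases indexed by \<open>I\<close> and \<open>K\<close>, which may be finite or infinite.
  The double sum is the unconditional one in the tensor product.  \<open>CBlinfun\<close> is meaningful
  because, for orthonormal bases, the function of \<open>A\<close> is bounded and complex-linear.
\<close>

definition J_map ::
    "('a :: chilbert_space \<Rightarrow> 'b :: chilbert_space \<Rightarrow> 'c :: chilbert_space)
      \<Rightarrow> ('i \<Rightarrow> 'a) \<Rightarrow> 'i set \<Rightarrow> ('k \<Rightarrow> 'b) \<Rightarrow> 'k set \<Rightarrow> (('a, 'b) hs, 'c) cblinfun" where
  "J_map tensor \<phi> I \<psi> K = CBlinfun (\<lambda>A.
     \<Sum>\<^sub>\<infinity>(i, j)\<in>K \<times> I. cinner (\<psi> i) (cblinfun_of_hs A *\<^sub>V \<phi> j) *\<^sub>C tensor (\<phi> j) (\<psi> i))"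

definition R_map ::
    "('a :: chilbert_space \<Rightarrow> 'b :: chilbert_space \<Rightarrow> 'c :: chilbert_space)
      \<Rightarrow> ('i \<Rightarrow> 'a) \<Rightarrow> 'i set \<Rightarrow> ('k \<Rightarrow> 'b) \<Rightarrow> 'k set
      \<Rightarrow> (('a, 'b) hs, ('a, 'b) hs) cblinfun \<Rightarrow> ('c, 'c) cblinfun" where
  "R_map tensor \<phi> I \<psi> K B =
     J_map tensor \<phi> I \<psi> K \<circ>\<^sub>C B \<circ>\<^sub>C cadjoint (J_map tensor \<phi> I \<psi> K)"

definition S_map ::
    "('a :: chilbert_space \<Rightarrow> 'b :: chilbert_space \<Rightarrow> 'c :: chilbert_space)
      \<Rightarrow> ('i \<Rightarrow> 'a) \<Rightarrow> 'i set \<Rightarrow> ('k \<Rightarrow> 'b) \<Rightarrow> 'k set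
      \<Rightarrow> ('c, 'c) cblinfun \<Rightarrow> (('a, 'b) hs, ('a, 'b) hs) cblinfun" where
  "S_map tensor \<phi> I \<psi> K C =
     cadjoint (J_map tensor \<phi> I \<psi> K) \<circ>\<^sub>C C \<circ>\<^sub>C J_map tensor \<phi> I \<psi> K"

end

theory Submission
  imports Defs
begin

text \<open>
  The rank-one operators \<open>|\<psi>\<^sub>i\<rangle>\<langle>\<phi>\<^sub>j|\<close> form an orthonormal basis of the Hilbert-Schmidt operators,
  the coefficients of \<open>A\<close> in it being \<open>\<langle>\<psi>\<^sub>i, A \<phi>\<^sub>j\<rangle>\<close>, and the vectors \<open>\<phi>\<^sub>j \<otimes> \<psi>\<^sub>i\<close> form an orthonormal
  basis of the tensor product.  Hence \<open>J\<close> carries one orthonormal basis to the other with the same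
  coefficients, so it is unitary, and conjugation by a unitary is a C*-isomorphism whose inverse
  is conjugation by the adjoint.
\<close>

section \<open>Orthonormal expansions\<close>

definition orthonormal_on :: "('i \<Rightarrow> 'a :: complex_inner) \<Rightarrow> 'i set \<Rightarrow> bool" where
  "orthonormal_on e I \<longleftrightarrow> (\<forall>i\<in>I. \<forall>j\<in>I. cinner (e i) (e j) = (if i = j then 1 else 0))"

lemma orthonormal_onD:
  "orthonormal_on e I \<Longrightarrow> i \<in> I \<Longrightarrow> j \<in> I \<Longrightarrow> cinner (e i) (e j) = (if i = j then 1 else 0)"
  by (simp add: orthonormal_on_def)

lemma orthonormal_basis_orthonormal_on: "orthonormal_basis e I \<Longrightarrow> orthonormal_on e I"
  by (simp add: orthonormal_basis_def orthonormal_on_def)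

lemma norm_orthonormal_sum:
  fixes e :: "'i \<Rightarrow> 'a :: complex_inner"
  assumes on: "orthonormal_on e I"
    and F: "finite F" "F \<subseteq> I"
  shows "(norm (\<Sum>i\<in>F. c i *\<^sub>C e i))\<^sup>2 = (\<Sum>i\<in>F. (cmod (c i))\<^sup>2)"
proof -
  define y where "y = (\<Sum>i\<in>F. c i *\<^sub>C e i)"
  have ey: "cinner (e i) y = c i" if "i \<in> F" for i
  proof -
    have "cinner (e i) y = (\<Sum>j\<in>F. c j * cinner (e i) (e j))"
      by (simp add: y_def cinner_sum_right cinner_scaleC_right)
    also have "\<dots> = (\<Sum>j\<in>F. if i = j then c j else 0)"
      using that F by (intro sum.cong) (auto simp: orthonormal_onD[OF on] subset_iff)
    also have "\<dots> = c i" using that F(1) by simp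
    finally show ?thesis .
  qed
  have "cinner y y = cinner (\<Sum>i\<in>F. c i *\<^sub>C e i) y" by (simp only: y_def)
  also have "\<dots> = (\<Sum>i\<in>F. cnj (c i) * c i)"
    by (simp add: cinner_sum_left cinner_scaleC_left ey)
  also have "\<dots> = complex_of_real (\<Sum>i\<in>F. (cmod (c i))\<^sup>2)"
    by (simp only: of_real_sum complex_norm_square mult.commute)
  finally show ?thesis by (simp only: cinner_self of_real_eq_iff y_def)
qed

text \<open>The partial expansion \<open>y\<close> satisfies
  \<open>inner y x = (norm y)\<^sup>2\<close>, so \<open>x - y\<close> has squared norm
  \<open>(norm x)\<^sup>2 - (norm y)\<^sup>2\<close>, which is non-negative.\<close>

lemma bessel_sum:
  fixes e :: "'i \<Rightarrow> 'a :: complex_inner"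
  assumes on: "orthonormal_on e I"
    and F: "finite F" "F \<subseteq> I"
  shows "(\<Sum>i\<in>F. (cmod (cinner (e i) x))\<^sup>2) \<le> (norm x)\<^sup>2"
proof -
  define y where "y = (\<Sum>i\<in>F. cinner (e i) x *\<^sub>C e i)"
  have "cinner y x = (\<Sum>i\<in>F. cnj (cinner (e i) x) * cinner (e i) x)"
    by (simp add: y_def cinner_sum_left cinner_scaleC_left)
  also have "\<dots> = complex_of_real (\<Sum>i\<in>F. (cmod (cinner (e i) x))\<^sup>2)"
    by (simp only: of_real_sum complex_norm_square mult.commute)
  also have "\<dots> = complex_of_real ((norm y)\<^sup>2)"
    unfolding y_def by (subst norm_orthonormal_sum[OF on F]) simp
  finally have yx: "inner y x = (norm y)\<^sup>2" by (simp add: inner_eq_Re_cinner)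
  have "0 \<le> inner (x - y) (x - y)" by simp
  also have "\<dots> = (norm x)\<^sup>2 - (norm y)\<^sup>2"
    using yx by (simp add: inner_diff_left inner_diff_right inner_commute[of x y] power2_norm_eq_inner)
  finally have "(norm y)\<^sup>2 \<le> (norm x)\<^sup>2" by simp
  then show ?thesis unfolding y_def by (subst (asm) norm_orthonormal_sum[OF on F]) simp
qed

lemma bessel_summable:
  fixes e :: "'i \<Rightarrow> 'a :: complex_inner"
  assumes on: "orthonormal_on e I"
  shows "(\<lambda>i. (cmod (cinner (e i) x))\<^sup>2) summable_on I"
  by (intro nonneg_bdd_above_summable_on bdd_aboveI2[where M = "(norm x)\<^sup>2"])
    (auto intro!: bessel_sum[OF on])

text \<open>By Pythagoras, distances between nested partial sums are differences of partial sums of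
  the squared coefficients. The net of partial sums over finite subsets is therefore Cauchy, and
  completeness gives its limit.\<close>

lemma riesz_fischer:
  fixes e :: "'i \<Rightarrow> 'a :: chilbert_space"
  assumes on: "orthonormal_on e I"
    and c: "(\<lambda>i. (cmod (c i))\<^sup>2) summable_on I"
  shows "(\<lambda>i. c i *\<^sub>C e i) summable_on I"
proof -
  define g where "g i = (cmod (c i))\<^sup>2" for i
  define s where "s = sum (\<lambda>i. c i *\<^sub>C e i)"
  have g: "g summable_on I" using c by (simp add: g_def[abs_def])
  define L where "L = infsum g I"
  have lim: "(sum g \<longlongrightarrow> L) (finite_subsets_at_top I)"
    using has_sum_infsum[OF g] by (simp add: has_sum_def L_def)
  have "\<exists>P. eventually P (finite_subsets_at_top I) \<and>
      (\<forall>F F'. P F \<and> P F' \<longrightarrow> dist (s F) (s F') < r)" if "r > 0" for r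
  proof -
    \<comment> \<open>\<open>P\<close> selects the finite sets whose squared coefficients already
      exhaust the total \<open>L\<close> up to \<open>(r / 2)\<^sup>2\<close>; enlarging such a set
      within \<open>I\<close> moves the vector sum by less than \<open>r / 2\<close>.\<close>
    define P where "P F \<longleftrightarrow> (finite F \<and> F \<subseteq> I) \<and> L - (r / 2)\<^sup>2 < sum g F" for F
    have "\<forall>\<^sub>F F in finite_subsets_at_top I. L - (r / 2)\<^sup>2 < sum g F"
      using that by (intro order_tendstoD(1)[OF lim]) simp
    then have "eventually P (finite_subsets_at_top I)"
      unfolding P_def by (intro eventually_conj) (auto intro: eventually_finite_subsets_at_top_weakI)
    moreover have "dist (s F) (s F') < r" if "P F" "P F'" for F F'
    proof -
      \<comment> \<open>Two sets satisfying \<open>P\<close> need not be nested, so both are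
        compared with their union.\<close>
      have half: "dist (s (F \<union> F')) (s G) < r / 2" if "P G" "G \<subseteq> F \<union> F'" for G
      proof (rule power_less_imp_less_base[where n = 2])
        have fin: "finite (F \<union> F')" "F \<union> F' \<subseteq> I" using \<open>P F\<close> \<open>P F'\<close> by (auto simp: P_def)
        have "s (F \<union> F') - s G = s (F \<union> F' - G)"
          unfolding s_def using fin that by (simp add: sum_diff)
        then have "(dist (s (F \<union> F')) (s G))\<^sup>2 = sum g (F \<union> F' - G)"
          unfolding dist_norm s_def g_def using fin norm_orthonormal_sum[OF on, of "F \<union> F' - G" c]
          by auto
        also have "\<dots> = sum g (F \<union> F') - sum g G" using fin that by (simp add: sum_diff)
        also have "\<dots> \<le> L - sum g G"
          unfolding L_def using fin finite_sum_le_infsum[OF g fin] by (simp add: g_def)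
        also have "\<dots> < (r / 2)\<^sup>2" using \<open>P G\<close> by (simp add: P_def)
        finally show "(dist (s (F \<union> F')) (s G))\<^sup>2 < (r / 2)\<^sup>2" .
      qed (use \<open>r > 0\<close> in simp)
      show ?thesis
        using half[OF \<open>P F\<close>] half[OF \<open>P F'\<close>] dist_triangle3[of "s F" "s F'" "s (F \<union> F')"] by simp
    qed
    ultimately show ?thesis by blast
  qed
  \<comment> \<open>The partial sums form a net, not a sequence, so completeness is used in its
    filter form.\<close>
  then have "cauchy_filter (filtermap s (finite_subsets_at_top I))"
    by (simp add: cauchy_filter_metric_filtermap)
  then have "convergent_filter (filtermap s (finite_subsets_at_top I))"
    by (rule cauchy_filter_convergent)
  then obtain l where "(s \<longlongrightarrow> l) (finite_subsets_at_top I)"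
    by (auto simp: convergent_filter_iff filterlim_def)
  then show ?thesis unfolding s_def summable_on_def has_sum_def by blast
qed

section \<open>Totality, orthonormal expansion and Parseval's identity\<close>

lemma subspace_orthogonal: "complex_vector.subspace {z. cinner (y :: 'a :: complex_inner) z = 0}"
  by (auto simp: complex_vector.subspace_def cinner_add_right cinner_scaleC_right)

lemma closed_orthogonal: "closed {z. cinner (y :: 'a :: complex_inner) z = 0}"
  by (intro closed_Collect_eq continuous_intros
      bounded_linear.continuous_on[OF bounded_linear_cinner_right])

text \<open>Serves as an induction principle: a condition that cuts out a closed subspace need only
  be checked on a total set.\<close>

lemma closed_subspace_total:
  assumes "closure (cspan S) = UNIV" "closed M" "complex_vector.subspace M" "S \<subseteq> M"
  shows "M = UNIV"
  using closure_minimal[OF complex_vector.span_minimal[OF assms(4,3)] assms(2)] assms(1) by auto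

text \<open>The vectors orthogonal to \<open>y\<close> form a closed subspace; if it contains
  \<open>S\<close>, it contains \<open>y\<close> itself.\<close>

lemma orthogonal_total_eq_0:
  fixes y :: "'a :: complex_inner"
  assumes "closure (cspan S) = UNIV" and orth: "\<And>s. s \<in> S \<Longrightarrow> cinner s y = 0"
  shows "y = 0"
proof -
  have "cinner y s = 0" if "s \<in> S" for s
    using orth[OF that] by (subst cinner_commute) simp
  then have "{z. cinner y z = 0} = UNIV"
    by (intro closed_subspace_total[OF assms(1) closed_orthogonal subspace_orthogonal]) auto
  then have "cinner y y = 0" by blast
  then show ?thesis by (simp add: cinner_self)
qed

lemma orthonormal_basis_eq_0:
  assumes "orthonormal_basis e I" "\<And>i. i \<in> I \<Longrightarrow> cinner (e i) y = 0"
  shows "y = 0"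
  using assms orthogonal_total_eq_0[of "e ` I" y] by (auto simp: orthonormal_basis_def)

text \<open>Completeness enters through the projection \<open>m\<close> of \<open>x\<close> onto the
  closed span: the residual \<open>x - m\<close> is orthogonal to every \<open>e i\<close>, hence
  zero by \<open>total\<close>.\<close>

lemma orthonormal_basisI:
  fixes e :: "'i \<Rightarrow> 'a :: chilbert_space"
  assumes "\<And>i j. i \<in> I \<Longrightarrow> j \<in> I \<Longrightarrow> cinner (e i) (e j) = (if i = j then 1 else 0)"
    and total: "\<And>y. (\<And>i. i \<in> I \<Longrightarrow> cinner (e i) y = 0) \<Longrightarrow> y = 0"
  shows "orthonormal_basis e I"
proof -
  have "x \<in> closure (cspan (e ` I))" for x
  proof -
    obtain m where m: "m \<in> closure (cspan (e ` I))"
      and orth: "\<forall>k\<in>closure (cspan (e ` I)). cinner k (x - m) = 0"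
      by (rule bexE[OF orthogonal_projection_exists[OF closed_closure subspace_closure_cspan]])
    have "x - m = 0"
    proof (rule total)
      fix i assume "i \<in> I"
      then have "e i \<in> closure (cspan (e ` I))"
        by (intro subsetD[OF closure_subset] complex_vector.span_base imageI)
      then show "cinner (e i) (x - m) = 0" by (rule orth[rule_format])
    qed
    with m show ?thesis by simp
  qed
  with assms(1) show ?thesis by (auto simp: orthonormal_basis_def)
qed

text \<open>The functional \<open>cinner (e k)\<close> is continuous, so it acts termwise, and only
  the term at \<open>k\<close> survives.\<close>

lemma cinner_orthonormal_has_sum:
  fixes e :: "'i \<Rightarrow> 'a :: complex_inner"
  assumes on: "orthonormal_on e I"
    and s: "((\<lambda>i. c i *\<^sub>C e i) has_sum s) I" and k: "k \<in> I"
  shows "cinner (e k) s = c k"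
proof (rule has_sum_unique)
  show "((\<lambda>i. cinner (e k) (c i *\<^sub>C e i)) has_sum cinner (e k) s) I"
    by (rule has_sum_bounded_linear[OF bounded_linear_cinner_right s])
  have "((\<lambda>i. cinner (e k) (c i *\<^sub>C e i)) has_sum c k) {k}"
    using k by (simp add: has_sum_finite_iff cinner_scaleC_right orthonormal_onD[OF on])
  then show "((\<lambda>i. cinner (e k) (c i *\<^sub>C e i)) has_sum c k) I"
    by (rule has_sum_cong_neutral[THEN iffD1, rotated -1])
      (use k in \<open>auto simp: cinner_scaleC_right orthonormal_onD[OF on]\<close>)
qed

text \<open>Bessel and Riesz-Fischer provide some limit \<open>s\<close>; since \<open>s\<close> has
  the same coefficients as \<open>x\<close>, totality forces \<open>s = x\<close>.\<close>

lemma orthonormal_expansion: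
  fixes x :: "'a :: chilbert_space"
  assumes onb: "orthonormal_basis e I"
  shows "((\<lambda>i. cinner (e i) x *\<^sub>C e i) has_sum x) I"
proof -
  note on = orthonormal_basis_orthonormal_on[OF onb]
  obtain s where s: "((\<lambda>i. cinner (e i) x *\<^sub>C e i) has_sum s) I"
    using riesz_fischer[OF on bessel_summable[OF on]] by (auto simp: summable_on_def)
  have "x - s = 0"
    by (rule orthonormal_basis_eq_0[OF onb])
      (simp add: cinner_diff cinner_orthonormal_has_sum[OF on s])
  with s show ?thesis by simp
qed

lemma parseval_cinner:
  fixes x y :: "'a :: chilbert_space"
  assumes "orthonormal_basis e I"
  shows "((\<lambda>i. cinner x (e i) * cinner (e i) y) has_sum cinner x y) I"
  using has_sum_bounded_linear[OF bounded_linear_cinner_right orthonormal_expansion[OF assms], of x y]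
  by (simp add: cinner_scaleC_right mult.commute)

section \<open>Unitaries between Hilbert spaces with bases over the same index set\<close>

lemma cadjoint_eqI:
  assumes "\<And>x y. cinner (A *\<^sub>V x) y = cinner x (B *\<^sub>V y)"
  shows "cadjoint A = B"
  by (intro cblinfun_eqI cinner_eqI) (simp add: cinner_cadjoint_right assms)

text \<open>The explicit sum is kept for the later match with \<open>J_map\<close>; the coefficient
  identity is the form from which unitarity is derived.\<close>

lemma basis_change_exists:
  fixes e :: "'i \<Rightarrow> 'a :: chilbert_space" and f :: "'i \<Rightarrow> 'b :: chilbert_space"
  assumes e: "orthonormal_basis e I" and f: "orthonormal_basis f I"
  obtains U where "\<And>x. U *\<^sub>V x = (\<Sum>\<^sub>\<infinity>i\<in>I. cinner (e i) x *\<^sub>C f i)"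
    and "\<And>i x. i \<in> I \<Longrightarrow> cinner (f i) (U *\<^sub>V x) = cinner (e i) x"
proof -
  define u where "u x = (\<Sum>\<^sub>\<infinity>i\<in>I. cinner (e i) x *\<^sub>C f i)" for x
  note oe = orthonormal_basis_orthonormal_on[OF e] and on = orthonormal_basis_orthonormal_on[OF f]
  have u: "((\<lambda>i. cinner (e i) x *\<^sub>C f i) has_sum u x) I" for x
    unfolding u_def by (intro has_sum_infsum riesz_fischer[OF on] bessel_summable[OF oe])
  have fu: "cinner (f i) (u x) = cinner (e i) x" if "i \<in> I" for i x
    by (rule cinner_orthonormal_has_sum[OF on u that])
  \<comment> \<open>Vectors are determined by their coefficients in \<open>f\<close>, so linearity
    of \<open>u\<close> reduces to linearity of the coefficients.\<close>
  have eqI: "y = z" if "\<And>i. i \<in> I \<Longrightarrow> cinner (f i) y = cinner (f i) z" for y z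
    using orthonormal_basis_eq_0[OF f, of "y - z"] that by (simp add: cinner_diff)
  have add: "u (x + y) = u x + u y" for x y
    by (rule eqI) (simp add: fu cinner_add_right)
  have scaleC: "u (c *\<^sub>C x) = c *\<^sub>C u x" for c x
    by (rule eqI) (simp add: fu cinner_scaleC_right)
  \<comment> \<open>Parseval for \<open>u x\<close> in \<open>f\<close> and for \<open>x\<close> in
    \<open>e\<close> sums the same terms.\<close>
  have norm: "norm (u x) = norm x" for x
  proof -
    have "((\<lambda>i. cinner (u x) (f i) * cinner (f i) (u x)) has_sum cinner (u x) (u x)) I"
      by (rule parseval_cinner[OF f])
    moreover have "cinner (u x) (f i) = cinner x (e i)" if "i \<in> I" for i
      using fu[OF that, of x] by (metis cinner_commute)
    ultimately have "((\<lambda>i. cinner x (e i) * cinner (e i) x) has_sum cinner (u x) (u x)) I"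
      by (simp add: fu cong: has_sum_cong)
    then have "cinner (u x) (u x) = cinner x x"
      using parseval_cinner[OF e] by (rule has_sum_unique)
    then show ?thesis by (simp only: cinner_self of_real_eq_iff) simp
  qed
  have "bounded_linear u"
    by (rule bounded_linear_intro[where K = 1]) (simp_all add: add scaleR_scaleC scaleC norm)
  then have app: "cblinfun_apply (CBlinfun u) = u"
    by (intro CBlinfun_inverse) (simp add: scaleC)
  show thesis
    by (rule that[of "CBlinfun u"]) (simp_all add: app fu, simp add: u_def)
qed

lemma basis_change_unitary:
  fixes e :: "'i \<Rightarrow> 'a :: chilbert_space" and f :: "'i \<Rightarrow> 'b :: chilbert_space"
  assumes e: "orthonormal_basis e I" and f: "orthonormal_basis f I"
    and U: "\<And>i x. i \<in> I \<Longrightarrow> cinner (f i) (U *\<^sub>V x) = cinner (e i) x"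
  shows "cadjoint U *\<^sub>V (U *\<^sub>V x) = x" and "U *\<^sub>V (cadjoint U *\<^sub>V y) = y"
proof -
  \<comment> \<open>\<open>V\<close> is the basis change in the reverse direction. It is first
    identified with the adjoint, and then both compositions are checked on coefficients.\<close>
  obtain V where V: "\<And>i x. i \<in> I \<Longrightarrow> cinner (e i) (V *\<^sub>V x) = cinner (f i) x"
    using basis_change_exists[OF f e] by metis
  have adj: "cadjoint U = V"
  proof (rule cadjoint_eqI)
    fix x y
    have "((\<lambda>i. cinner (U *\<^sub>V x) (f i) * cinner (f i) y) has_sum cinner (U *\<^sub>V x) y) I"
      by (rule parseval_cinner[OF f])
    moreover have "cinner (U *\<^sub>V x) (f i) * cinner (f i) y = cinner x (e i) * cinner (e i) (V *\<^sub>V y)"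
      if "i \<in> I" for i
      using U[OF that, of x] V[OF that, of y] by (metis cinner_commute)
    ultimately have "((\<lambda>i. cinner x (e i) * cinner (e i) (V *\<^sub>V y)) has_sum cinner (U *\<^sub>V x) y) I"
      by (simp cong: has_sum_cong)
    then show "cinner (U *\<^sub>V x) y = cinner x (V *\<^sub>V y)"
      using parseval_cinner[OF e] by (rule has_sum_unique)
  qed
  have "V *\<^sub>V (U *\<^sub>V x) - x = 0"
    by (rule orthonormal_basis_eq_0[OF e]) (simp add: cinner_diff U V)
  then show "cadjoint U *\<^sub>V (U *\<^sub>V x) = x" by (simp add: adj)
  have "U *\<^sub>V (V *\<^sub>V y) - y = 0"
    by (rule orthonormal_basis_eq_0[OF f]) (simp add: cinner_diff U V)
  then show "U *\<^sub>V (cadjoint U *\<^sub>V y) = y" by (simp add: adj)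
qed

section \<open>Conjugation by a unitary\<close>

lemma cadjoint_cadjoint: "cadjoint (cadjoint A) = A"
  by (rule cadjoint_eqI) (simp add: cinner_cadjoint_left)

lemma cadjoint_compose: "cadjoint (A \<circ>\<^sub>C B) = cadjoint B \<circ>\<^sub>C cadjoint A"
  by (rule cadjoint_eqI) (simp add: cblinfun_compose.rep_eq cinner_cadjoint_right)

lemma cblinfun_compose_assoc: "A \<circ>\<^sub>C B \<circ>\<^sub>C C = A \<circ>\<^sub>C (B \<circ>\<^sub>C C)"
  by transfer simp

context
  fixes U :: "('a :: chilbert_space, 'b :: chilbert_space) cblinfun"
  assumes adj_U: "\<And>x. cadjoint U *\<^sub>V (U *\<^sub>V x) = x" and U_adj: "\<And>y. U *\<^sub>V (cadjoint U *\<^sub>V y) = y"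
begin

lemma norm_unitary: "norm (U *\<^sub>V x) = norm x"
proof -
  have "cinner (U *\<^sub>V x) (U *\<^sub>V x) = cinner x x"
    by (simp add: adj_U flip: cinner_cadjoint_right)
  then show ?thesis by (simp only: cinner_self of_real_eq_iff) simp
qed

lemma norm_cadjoint_unitary: "norm (cadjoint U *\<^sub>V y) = norm y"
  using norm_unitary[of "cadjoint U *\<^sub>V y"] by (simp add: U_adj)

lemma unitary_conj_inverse: "U \<circ>\<^sub>C (cadjoint U \<circ>\<^sub>C C \<circ>\<^sub>C U) \<circ>\<^sub>C cadjoint U = C"
  by (rule cblinfun_eqI) (simp add: cblinfun_compose.rep_eq U_adj)

lemma unitary_conj_inverse': "cadjoint U \<circ>\<^sub>C (U \<circ>\<^sub>C B \<circ>\<^sub>C cadjoint U) \<circ>\<^sub>C U = B"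
  by (rule cblinfun_eqI) (simp add: cblinfun_compose.rep_eq adj_U)

text \<open>Products are preserved because the inner factor \<open>cadjoint U\<close> followed after
  \<open>U\<close> cancels; bijectivity comes from the explicit inverse, conjugation by
  \<open>cadjoint U\<close>.\<close>

lemma cstar_isomorphism_unitary_conj:
  "cstar_isomorphism (\<circ>\<^sub>C) cadjoint (\<circ>\<^sub>C) cadjoint (\<lambda>B. U \<circ>\<^sub>C B \<circ>\<^sub>C cadjoint U)"
proof (intro cstar_isomorphism.intro cstar_algebra_cblinfun cstar_isomorphism_axioms.intro)
  fix B B' :: "('a, 'a) cblinfun" and c :: complex
  show "bij (\<lambda>B. U \<circ>\<^sub>C B \<circ>\<^sub>C cadjoint U)"
    by (rule o_bij[where g = "\<lambda>C. cadjoint U \<circ>\<^sub>C C \<circ>\<^sub>C U"])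
      (auto simp: unitary_conj_inverse unitary_conj_inverse')
  show "U \<circ>\<^sub>C (B + B') \<circ>\<^sub>C cadjoint U = U \<circ>\<^sub>C B \<circ>\<^sub>C cadjoint U + U \<circ>\<^sub>C B' \<circ>\<^sub>C cadjoint U"
    by (rule cblinfun_eqI) (simp add: cblinfun_compose.rep_eq plus_cblinfun.rep_eq cblinfun_apply_add)
  show "U \<circ>\<^sub>C c *\<^sub>C B \<circ>\<^sub>C cadjoint U = c *\<^sub>C (U \<circ>\<^sub>C B \<circ>\<^sub>C cadjoint U)"
    by (rule cblinfun_eqI) (simp add: cblinfun_compose.rep_eq scaleC_cblinfun.rep_eq cblinfun_apply_scaleC)
  show "U \<circ>\<^sub>C (B \<circ>\<^sub>C B') \<circ>\<^sub>C cadjoint U = U \<circ>\<^sub>C B \<circ>\<^sub>C cadjoint U \<circ>\<^sub>C (U \<circ>\<^sub>C B' \<circ>\<^sub>C cadjoint U)"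
    by (rule cblinfun_eqI) (simp add: cblinfun_compose.rep_eq adj_U)
  show "U \<circ>\<^sub>C cadjoint B \<circ>\<^sub>C cadjoint U = cadjoint (U \<circ>\<^sub>C B \<circ>\<^sub>C cadjoint U)"
    by (simp add: cadjoint_compose cadjoint_cadjoint cblinfun_compose_assoc)
  show "norm (U \<circ>\<^sub>C B \<circ>\<^sub>C cadjoint U) = norm B"
  proof (rule antisym)
    show "norm (U \<circ>\<^sub>C B \<circ>\<^sub>C cadjoint U) \<le> norm B"
    proof (rule norm_cblinfun_bound)
      show "norm ((U \<circ>\<^sub>C B \<circ>\<^sub>C cadjoint U) *\<^sub>V y) \<le> norm B * norm y" for y
        using norm_cblinfun[of B "cadjoint U *\<^sub>V y"]
        by (simp add: cblinfun_compose.rep_eq norm_unitary norm_cadjoint_unitary)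
    qed simp
    \<comment> \<open>Evaluated at \<open>U *\<^sub>V x\<close>, the conjugated operator yields
      \<open>U *\<^sub>V (B *\<^sub>V x)\<close>, which has the norm of
      \<open>B *\<^sub>V x\<close>.\<close>
    show "norm B \<le> norm (U \<circ>\<^sub>C B \<circ>\<^sub>C cadjoint U)"
    proof (rule norm_cblinfun_bound)
      show "norm (B *\<^sub>V x) \<le> norm (U \<circ>\<^sub>C B \<circ>\<^sub>C cadjoint U) * norm x" for x
        using norm_cblinfun[of "U \<circ>\<^sub>C B \<circ>\<^sub>C cadjoint U" "U *\<^sub>V x"]
        by (simp add: cblinfun_compose.rep_eq norm_unitary adj_U)
    qed simp
  qed
qed

end

section \<open>Bases of the Hilbert-Schmidt operators and of the tensor product\<close>

lift_definition rank_one :: "'b \<Rightarrow> 'a \<Rightarrow> ('a :: chilbert_space, 'b :: chilbert_space) cblinfun"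
  is "\<lambda>b a x. cinner a x *\<^sub>C b"
proof (intro conjI allI)
  fix b :: 'b and a :: 'a
  show "bounded_linear (\<lambda>x. cinner a x *\<^sub>C b)"
  proof (rule bounded_linear_intro)
    show "norm (cinner a x *\<^sub>C b) \<le> norm x * (norm a * norm b)" for x
      using mult_right_mono[OF norm_cinner_le[of a x] norm_ge_zero[of b]]
      by (simp add: norm_scaleC mult_ac)
  qed (simp_all add: cinner_add_right scaleC_add_left scaleR_scaleC cinner_scaleC_right scaleC_scaleC)
qed (simp add: cinner_scaleC_right scaleC_scaleC)

lift_definition rank_one_hs :: "'b \<Rightarrow> 'a \<Rightarrow> ('a :: chilbert_space, 'b :: chilbert_space) hs"
  is rank_one
proof -
  fix b :: 'b and a :: 'a
  \<comment> \<open>These are the squared norms of the values of the operator on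
    \<open>some_onb\<close>; Bessel for \<open>a\<close> makes them summable.\<close>
  have "(\<lambda>e. (cmod (cinner e a))\<^sup>2 * (norm b)\<^sup>2) summable_on some_onb"
    using bessel_summable[OF orthonormal_basis_orthonormal_on[OF orthonormal_basis_some_onb], of a]
    by (intro summable_on_cmult_left) simp
  moreover have "cmod (cinner a e) = cmod (cinner e a)" for e
    by (subst cinner_commute) simp
  ultimately show "hilbert_schmidt (rank_one b a)"
    by (simp add: hilbert_schmidt_iff rank_one.rep_eq norm_scaleC power_mult_distrib)
qed

text \<open>With \<open>T\<close> the operator underlying \<open>A\<close>, moving \<open>T\<close>
  to \<open>b\<close> as its adjoint turns the trace into a Parseval sum for
  \<open>cadjoint T *\<^sub>V b\<close> and \<open>a\<close>. This exhibits the coefficients in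
  \<open>J_map\<close> as Fourier coefficients of \<open>A\<close>.\<close>

lemma cinner_rank_one_hs:
  "cinner (rank_one_hs b a) A = cinner b (cblinfun_of_hs A *\<^sub>V a)"
proof -
  let ?T = "cblinfun_of_hs A"
  have "cinner (rank_one_hs b a) A
      = (\<Sum>\<^sub>\<infinity>e\<in>some_onb. cinner (cadjoint ?T *\<^sub>V b) e * cinner e a)"
    unfolding cinner_hs_infsum rank_one_hs.rep_eq rank_one.rep_eq cinner_scaleC_left
    by (simp add: cinner_cadjoint_left mult.commute flip: cinner_commute)
  also have "\<dots> = cinner (cadjoint ?T *\<^sub>V b) a"
    by (rule infsumI[OF parseval_cinner[OF orthonormal_basis_some_onb]])
  finally show ?thesis by (simp add: cinner_cadjoint_left)
qed

lemma orthonormal_basis_rank_one_hs: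
  fixes \<phi> :: "'i \<Rightarrow> 'a :: chilbert_space" and \<psi> :: "'k \<Rightarrow> 'b :: chilbert_space"
  assumes \<phi>: "orthonormal_basis \<phi> I" and \<psi>: "orthonormal_basis \<psi> K"
  shows "orthonormal_basis (\<lambda>(i, j). rank_one_hs (\<psi> i) (\<phi> j)) (K \<times> I)"
proof (rule orthonormal_basisI)
  fix p q assume "p \<in> K \<times> I" "q \<in> K \<times> I"
  then show "cinner (case p of (i, j) \<Rightarrow> rank_one_hs (\<psi> i) (\<phi> j))
      (case q of (i, j) \<Rightarrow> rank_one_hs (\<psi> i) (\<phi> j)) = (if p = q then 1 else 0)"
    by (auto simp: cinner_rank_one_hs rank_one_hs.rep_eq rank_one.rep_eq cinner_scaleC_right
        orthonormal_onD[OF orthonormal_basis_orthonormal_on[OF \<phi>]]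
        orthonormal_onD[OF orthonormal_basis_orthonormal_on[OF \<psi>]]
        split: if_splits)
next
  fix A :: "('a, 'b) hs"
  assume *: "\<And>p. p \<in> K \<times> I \<Longrightarrow> cinner (case p of (i, j) \<Rightarrow> rank_one_hs (\<psi> i) (\<phi> j)) A = 0"
  have zero: "cblinfun_of_hs A *\<^sub>V \<phi> j = 0" if "j \<in> I" for j
    by (rule orthonormal_basis_eq_0[OF \<psi>]) (use *[of "(_, j)"] that in \<open>simp add: cinner_rank_one_hs\<close>)
  \<comment> \<open>Passing to the adjoint replaces a density argument: the coefficients of
    \<open>cadjoint (cblinfun_of_hs A) *\<^sub>V y\<close> in \<phi> are inner products of the
    vanishing images of the \<phi> j with \<open>y\<close>.\<close>
  have "cadjoint (cblinfun_of_hs A) *\<^sub>V y = 0" for y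
    by (rule orthonormal_basis_eq_0[OF \<phi>]) (simp add: cinner_cadjoint_right zero)
  then have "cblinfun_of_hs A *\<^sub>V x = 0" for x
    by (intro cinner_eqI) (simp flip: cinner_cadjoint_left)
  then have "cblinfun_of_hs A = 0" by (intro cblinfun_eqI) (simp add: zero_cblinfun.rep_eq)
  then show "A = 0" by transfer
qed

section \<open>The product basis of the tensor product and unitarity of J\<close>

context hilbert_tensor_product
begin

lemma norm_tensor: "norm (a \<otimes> b) = norm a * norm b"
proof -
  have "cinner (a \<otimes> b) (a \<otimes> b) = cinner a a * cinner b b" by (rule cinner_tensor)
  then have "complex_of_real ((norm (a \<otimes> b))\<^sup>2) = complex_of_real ((norm a * norm b)\<^sup>2)"
    by (simp add: cinner_self power_mult_distrib)
  then have "(norm (a \<otimes> b))\<^sup>2 = (norm a * norm b)\<^sup>2" by (simp only: of_real_eq_iff)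
  then show ?thesis by simp
qed

lemma bounded_linear_tensor_left: "bounded_linear (\<lambda>a. a \<otimes> b)"
  by (rule bounded_linear_intro[where K = "norm b"])
    (simp_all add: tensor_add_left tensor_scaleC_left scaleR_scaleC norm_tensor)

lemma bounded_linear_tensor_right: "bounded_linear (\<lambda>b. a \<otimes> b)"
  by (rule bounded_linear_intro[where K = "norm a"])
    (simp_all add: tensor_add_right tensor_scaleC_right scaleR_scaleC norm_tensor mult.commute)

text \<open>Totality is proved one factor at a time: orthogonality to the product vectors extends
  from \<phi> j to arbitrary \<open>a\<close>, then from \<psi> i to arbitrary \<open>b\<close>, and
  the elementary tensors are total.\<close>

lemma orthonormal_basis_tensor:
  assumes \<phi>: "orthonormal_basis \<phi> I" and \<psi>: "orthonormal_basis \<psi> K"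
  shows "orthonormal_basis (\<lambda>(i, j). \<phi> j \<otimes> \<psi> i) (K \<times> I)"
proof (rule orthonormal_basisI)
  fix p q assume "p \<in> K \<times> I" "q \<in> K \<times> I"
  then show "cinner (case p of (i, j) \<Rightarrow> \<phi> j \<otimes> \<psi> i) (case q of (i, j) \<Rightarrow> \<phi> j \<otimes> \<psi> i)
      = (if p = q then 1 else 0)"
    by (auto simp: cinner_tensor
        orthonormal_onD[OF orthonormal_basis_orthonormal_on[OF \<phi>]]
        orthonormal_onD[OF orthonormal_basis_orthonormal_on[OF \<psi>]]
        split: if_splits)
next
  fix y assume *: "\<And>p. p \<in> K \<times> I \<Longrightarrow> cinner (case p of (i, j) \<Rightarrow> \<phi> j \<otimes> \<psi> i) y = 0"
  \<comment> \<open>With \<open>y\<close> in the first argument, the vanishing conditions below are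
    linear in \<open>a\<close> and in \<open>b\<close>.\<close>
  have flip: "cinner z w = 0" if "cinner w z = 0" for z w :: 'c
    using that by (subst cinner_commute) simp
  have 1: "cinner y (a \<otimes> \<psi> i) = 0" if i: "i \<in> K" for a i
  proof -
    have "{a. cinner y (a \<otimes> \<psi> i) = 0} = UNIV"
    proof (rule closed_subspace_total)
      show "closure (cspan (\<phi> ` I)) = UNIV" using \<phi> by (simp add: orthonormal_basis_def)
      show "closed {a. cinner y (a \<otimes> \<psi> i) = 0}"
        by (intro closed_Collect_eq continuous_on_const bounded_linear.continuous_on[OF
            bounded_linear_compose[OF bounded_linear_cinner_right bounded_linear_tensor_left]] continuous_on_id)
      show "complex_vector.subspace {a. cinner y (a \<otimes> \<psi> i) = 0}"
        using bounded_linear.linear[OF bounded_linear_tensor_left[of "\<psi> i"], THEN linear_0]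
        by (auto simp: complex_vector.subspace_def tensor_add_left tensor_scaleC_left
            cinner_add_right cinner_scaleC_right)
      show "\<phi> ` I \<subseteq> {a. cinner y (a \<otimes> \<psi> i) = 0}" using *[of "(i, _)"] i by (auto intro!: flip[of _ y])
    qed
    then show ?thesis by blast
  qed
  have 2: "cinner y (a \<otimes> b) = 0" for a b
  proof -
    have "{b. cinner y (a \<otimes> b) = 0} = UNIV"
    proof (rule closed_subspace_total)
      show "closure (cspan (\<psi> ` K)) = UNIV" using \<psi> by (simp add: orthonormal_basis_def)
      show "closed {b. cinner y (a \<otimes> b) = 0}"
        by (intro closed_Collect_eq continuous_on_const bounded_linear.continuous_on[OF
            bounded_linear_compose[OF bounded_linear_cinner_right bounded_linear_tensor_right]] continuous_on_id)
      show "complex_vector.subspace {b. cinner y (a \<otimes> b) = 0}"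
        using bounded_linear.linear[OF bounded_linear_tensor_right[of a], THEN linear_0]
        by (auto simp: complex_vector.subspace_def tensor_add_right tensor_scaleC_right
            cinner_add_right cinner_scaleC_right)
      show "\<psi> ` K \<subseteq> {b. cinner y (a \<otimes> b) = 0}" using 1 by auto
    qed
    then show ?thesis by blast
  qed
  show "y = 0"
    by (rule orthogonal_total_eq_0[OF tensor_total]) (use flip[OF 2] in auto)
qed

lemma J_map_unitary:
  assumes \<phi>: "orthonormal_basis \<phi> I" and \<psi>: "orthonormal_basis \<psi> K"
  shows "cadjoint (J_map (\<otimes>) \<phi> I \<psi> K) *\<^sub>V (J_map (\<otimes>) \<phi> I \<psi> K *\<^sub>V A) = A"
    and "J_map (\<otimes>) \<phi> I \<psi> K *\<^sub>V (cadjoint (J_map (\<otimes>) \<phi> I \<psi> K) *\<^sub>V y) = y"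
proof -
  note e = orthonormal_basis_rank_one_hs[OF \<phi> \<psi>] and f = orthonormal_basis_tensor[OF \<phi> \<psi>]
  obtain U where U: "\<And>A. U *\<^sub>V A = (\<Sum>\<^sub>\<infinity>p\<in>K \<times> I.
        cinner (case p of (i, j) \<Rightarrow> rank_one_hs (\<psi> i) (\<phi> j)) A *\<^sub>C (case p of (i, j) \<Rightarrow> \<phi> j \<otimes> \<psi> i))"
    and coeff: "\<And>p A. p \<in> K \<times> I \<Longrightarrow> cinner (case p of (i, j) \<Rightarrow> \<phi> j \<otimes> \<psi> i) (U *\<^sub>V A)
        = cinner (case p of (i, j) \<Rightarrow> rank_one_hs (\<psi> i) (\<phi> j)) A"
    using basis_change_exists[OF e f] by blast
  have "cblinfun_apply U = (\<lambda>A. \<Sum>\<^sub>\<infinity>(i, j)\<in>K \<times> I.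
      cinner (\<psi> i) (cblinfun_of_hs A *\<^sub>V \<phi> j) *\<^sub>C (\<phi> j \<otimes> \<psi> i))"
    unfolding U by (intro ext infsum_cong) (auto simp: cinner_rank_one_hs)
  \<comment> \<open>\<open>CBlinfun\<close> has a specified value only on bounded complex-linear
    functions. The sum in \<open>J_map\<close> is the function underlying \<open>U\<close>, so
    \<open>CBlinfun\<close> returns \<open>U\<close>.\<close>
  then have J: "J_map (\<otimes>) \<phi> I \<psi> K = U"
    unfolding J_map_def by (metis cblinfun_apply_inverse)
  show "cadjoint (J_map (\<otimes>) \<phi> I \<psi> K) *\<^sub>V (J_map (\<otimes>) \<phi> I \<psi> K *\<^sub>V A) = A"
    unfolding J by (rule basis_change_unitary(1)[OF e f coeff])
  show "J_map (\<otimes>) \<phi> I \<psi> K *\<^sub>V (cadjoint (J_map (\<otimes>) \<phi> I \<psi> K) *\<^sub>V y) = y"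
    unfolding J by (rule basis_change_unitary(2)[OF e f coeff])
qed

end

theorem theorem1p7:
  fixes tensor :: "'a :: chilbert_space \<Rightarrow> 'b :: chilbert_space \<Rightarrow> 'c :: chilbert_space"
    and \<phi> :: "nat \<Rightarrow> 'a" and \<psi> :: "nat \<Rightarrow> 'b" and I K :: "nat set"
  assumes "separable_space (euclidean :: 'a topology)"
    and "separable_space (euclidean :: 'b topology)"
    and "hilbert_tensor_product tensor"
    and "orthonormal_basis \<phi> I" and "orthonormal_basis \<psi> K"
  shows "cstar_isomorphism (\<circ>\<^sub>C) cadjoint (\<circ>\<^sub>C) cadjoint (R_map tensor \<phi> I \<psi> K) \<and>
    cstar_isomorphism (\<circ>\<^sub>C) cadjoint (\<circ>\<^sub>C) cadjoint (S_map tensor \<phi> I \<psi> K) \<and>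
    S_map tensor \<phi> I \<psi> K = inv (R_map tensor \<phi> I \<psi> K)"
proof -
  define J where "J = J_map tensor \<phi> I \<psi> K"
  have JJ: "cadjoint J *\<^sub>V (J *\<^sub>V A) = A" "J *\<^sub>V (cadjoint J *\<^sub>V y) = y" for A y
    unfolding J_def by (rule hilbert_tensor_product.J_map_unitary[OF assms(3-5)])+
  have R: "R_map tensor \<phi> I \<psi> K = (\<lambda>B. J \<circ>\<^sub>C B \<circ>\<^sub>C cadjoint J)"
    by (simp add: R_map_def J_def fun_eq_iff)
  have S: "S_map tensor \<phi> I \<psi> K = (\<lambda>C. cadjoint J \<circ>\<^sub>C C \<circ>\<^sub>C J)"
    by (simp add: S_map_def J_def fun_eq_iff)
  have "cstar_isomorphism (\<circ>\<^sub>C) cadjoint (\<circ>\<^sub>C) cadjoint (\<lambda>B. J \<circ>\<^sub>C B \<circ>\<^sub>C cadjoint J)"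
    by (rule cstar_isomorphism_unitary_conj) (rule JJ)+
  \<comment> \<open>\<open>S_map\<close> is conjugation by the unitary \<open>cadjoint J\<close>,
    whose adjoint is \<open>J\<close>; the double adjoint is simplified at the end.\<close>
  moreover have "cstar_isomorphism (\<circ>\<^sub>C) cadjoint (\<circ>\<^sub>C) cadjoint
      (\<lambda>C. cadjoint J \<circ>\<^sub>C C \<circ>\<^sub>C cadjoint (cadjoint J))"
    by (rule cstar_isomorphism_unitary_conj) (simp_all add: cadjoint_cadjoint JJ)
  moreover have "inv (\<lambda>B. J \<circ>\<^sub>C B \<circ>\<^sub>C cadjoint J) = (\<lambda>C. cadjoint J \<circ>\<^sub>C C \<circ>\<^sub>C J)"
    using unitary_conj_inverse[OF JJ] unitary_conj_inverse'[OF JJ] by (intro inv_equality)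
  ultimately show ?thesis by (simp add: R S cadjoint_cadjoint)
qed

end
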